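(* Let $f_1,\dots,f_n:\mathbb{R}^p\to\mathbb{R}$ be twice differentiable and $F(\mathbf{x})=\frac1n\sum_{i=1}^n f_i(\mathbf{x})$. Assume that there are constants $0<K_i<\infty$ with $0\preceq\nabla^2 f_i(\mathbf{x})\preceq K_i\mathbb{I}$ for all $\mathbf{x}\in\mathbb{R}^p$ and $i=1,\dots,n$, and constants $0<\gamma\le K<\infty$ with $\gamma\mathbb{I}\preceq\nabla^2F(\mathbf{x})\preceq K\mathbb{I}$ for all $\mathbf{x}\in\mathbb{R}^p$; let $\mathbf{x}^*$ be the minimizer of $F$. Let $0<\epsilon<1$, $0<\delta<1$, $0<\theta_2<1$, $0<\beta<1$, $\widehat\alpha\ge1$, $\lambda>0$ be given. For any $\mathbf{x}^{(k)}\in\mathbb{R}^p$, let $\mathbf{x}^{(k+1)}$ be obtained from $\mathbf{x}^{(k)}$ by one iteration of the ridge-regularized sub-sampled Newton algorithm described in the context, with $\mathcal{S}$ drawn uniformly at random without replacement with $|\mathcal{S}|\ge 2\kappa_1\ln(p/\delta)/\epsilon^2$, and inexact update with tolerances $\theta_1,\theta_2$. If $$\theta_1\le\frac12\sqrt{\frac{(1-\epsilon)\gamma+\lambda}{\widehat K_{|\mathcal{S}|}+\lambda}},$$ then $$F(\mathbf{x}^{(k+1)})-F(\mathbf{x}^* )\le(1-\rho)\big(F(\mathbf{x}^{(k)})-F(\mathbf{x}^* )\big),\qquad\rho=\frac{\alpha_k\beta\gamma}{\widehat K_{|\mathcal{S}|}+\lambda}.$$ Moreover, with probability $1-\delta$,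 the step size is at least $$\alpha_k\ge\frac{2(1-\theta_2)(1-\beta)\big((1-\epsilon)\gamma+\lambda\big)}{K}.$$
   Context: For an integer $1\le q\le n$, $\widehat K_q$ is the average of the $q$ largest values among $K_1,\dots,K_n$, and $\kappa_q=\widehat K_q/\gamma$. Algorithm (one iteration). Draw $\mathcal{S}$ from $\{1,\dots,n\}$, set $H(\mathbf{x}^{(k)})=\frac1{|\mathcal{S}|}\sum_{j\in\mathcal{S}}\nabla^2f_j(\mathbf{x}^{(k)})$ and $\hat H(\mathbf{x}^{(k)})=H(\mathbf{x}^{(k)})+\lambda\mathbb{I}$. Then $\mathbf{x}^{(k+1)}=\mathbf{x}^{(k)}+\alpha_k\mathbf{p}_k$, where, for a tolerance $\theta_1\ge0$, $\mathbf{p}_k$ is any vector satisfying both $$\|\hat H(\mathbf{x}^{(k)})\mathbf{p}_k+\nabla F(\mathbf{x}^{(k)})\|\le\theta_1\|\nabla F(\mathbf{x}^{(k)})\|,\qquad \mathbf{p}_k^T\nabla F(\mathbf{x}^{(k)})\le-(1-\theta_2)\,\mathbf{p}_k^T\hat H(\mathbf{x}^{(k)})\mathbf{p}_k,$$ and $\alpha_k$ is the largest $\alpha\le\widehat\alpha$ such that $F(\mathbf{x}^{(k)}+\alpha\mathbf{p}_k)\le F(\mathbf{x}^{(k)})+\alpha\beta\,\mathbf{p}_k^T\nabla F(\mathbf{x}^{(k)})$. "With probability $1-\delta$" means with probability at least $1-\delta$ over the draw of $\mathcal{S}$. $A\preceq B$ means $B-A$ is symmetric positive semi-definite.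
   Formalization: The step-size bound is proved as the minimum of the cap on the step size and the printed bound, since the printed bound can exceed the cap; the decrease in F is asserted jointly with it with probability 1−δ, since it can fail for an unlucky sample. *)

theory Defs
  imports "HOL-Analysis.Analysis" "HOL-Probability.Probability"
begin

definition gradient :: "(real ^ 'p \<Rightarrow> real) \<Rightarrow> real ^ 'p \<Rightarrow> real ^ 'p" where
  "gradient f x = (\<chi> i. frechet_derivative f (at x) (axis i 1))"

definition hessian :: "(real ^ 'p \<Rightarrow> real) \<Rightarrow> real ^ 'p \<Rightarrow> real ^ 'p ^ 'p" where
  "hessian f x = jacobian (gradient f) (at x)"

definition twice_differentiable :: "(real ^ 'p \<Rightarrow> real) \<Rightarrow> bool" where
  "twice_differentiable f \<longleftrightarrow>
     (\<forall>x. f differentiable (at x)) \<and> (\<forall>x. gradient f differentiable (at x))"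

definition loewner_le :: "real ^ 'p ^ 'p \<Rightarrow> real ^ 'p ^ 'p \<Rightarrow> bool" (infix "\<preceq>\<^sub>L" 50) where
  "A \<preceq>\<^sub>L B \<longleftrightarrow> transpose (B - A) = B - A \<and> (\<forall>v. 0 \<le> v \<bullet> ((B - A) *v v))"

definition average_fun :: "nat \<Rightarrow> (nat \<Rightarrow> real ^ 'p \<Rightarrow> real) \<Rightarrow> real ^ 'p \<Rightarrow> real" where
  "average_fun n f x = (1 / real n) * (\<Sum>i = 1..n. f i x)"

text \<open>The average of the \<open>q\<close> largest values, counted with multiplicity, among
  \<open>K 1, \<dots>, K n\<close>; meaningful for \<open>1 \<le> q \<le> n\<close>.\<close>

definition Khat :: "nat \<Rightarrow> (nat \<Rightarrow> real) \<Rightarrow> nat \<Rightarrow> real" where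
  "Khat n K q = sum_list (take q (rev (sort (map K [1..<Suc n])))) / real q"

definition kappa :: "nat \<Rightarrow> (nat \<Rightarrow> real) \<Rightarrow> real \<Rightarrow> nat \<Rightarrow> real" where
  "kappa n K \<gamma> q = Khat n K q / \<gamma>"

text \<open>The uniform distribution on the \<open>s\<close>-element subsets of \<open>{1..n}\<close>. The order in which
  the indices are drawn is forgotten, as the algorithm depends only on the resulting set.\<close>

definition sample_without_replacement :: "nat \<Rightarrow> nat \<Rightarrow> nat set pmf" where
  "sample_without_replacement n s = pmf_of_set {S. S \<subseteq> {1..n} \<and> card S = s}"

definition subsampled_hessian ::
  "(nat \<Rightarrow> real ^ 'p \<Rightarrow> real) \<Rightarrow> nat set \<Rightarrow> real ^ 'p \<Rightarrow> real ^ 'p ^ 'p" where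
  "subsampled_hessian f S x = (1 / real (card S)) *\<^sub>R (\<Sum>j\<in>S. hessian (f j) x)"

text \<open>In the library, \<open>mat c\<close> is \<open>c\<close> times the identity matrix.\<close>

definition ridge_hessian ::
  "(nat \<Rightarrow> real ^ 'p \<Rightarrow> real) \<Rightarrow> real \<Rightarrow> nat set \<Rightarrow> real ^ 'p \<Rightarrow> real ^ 'p ^ 'p" where
  "ridge_hessian f lam S x = subsampled_hessian f S x + mat lam"

definition inexact_direction ::
  "real ^ 'p ^ 'p \<Rightarrow> real ^ 'p \<Rightarrow> real \<Rightarrow> real \<Rightarrow> real ^ 'p \<Rightarrow> bool" where
  "inexact_direction H g \<theta>\<^sub>1 \<theta>\<^sub>2 p \<longleftrightarrow>
     norm (H *v p + g) \<le> \<theta>\<^sub>1 * norm g \<and>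
     p \<bullet> g \<le> - (1 - \<theta>\<^sub>2) * (p \<bullet> (H *v p))"

definition armijo ::
  "(real ^ 'p \<Rightarrow> real) \<Rightarrow> real \<Rightarrow> real ^ 'p \<Rightarrow> real ^ 'p \<Rightarrow> real \<Rightarrow> bool" where
  "armijo F \<beta> x p a \<longleftrightarrow> F (x + a *\<^sub>R p) \<le> F x + a * \<beta> * (p \<bullet> gradient F x)"

definition line_search_step ::
  "(real ^ 'p \<Rightarrow> real) \<Rightarrow> real \<Rightarrow> real \<Rightarrow> real ^ 'p \<Rightarrow> real ^ 'p \<Rightarrow> real \<Rightarrow> bool" where
  "line_search_step F \<beta> \<alpha>max x p \<alpha> \<longleftrightarrow>
     \<alpha> \<le> \<alpha>max \<and> armijo F \<beta> x p \<alpha> \<and> (\<forall>a \<le> \<alpha>max. armijo F \<beta> x p a \<longrightarrow> a \<le> \<alpha>)"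

text \<open>The iteration is a relation: for a given sample \<open>S\<close>, any \<open>p\<close> that meets the two
  tolerances may serve as the search direction. The last argument is the new iterate.\<close>

definition ridge_newton_step ::
  "nat \<Rightarrow> (nat \<Rightarrow> real ^ 'p \<Rightarrow> real) \<Rightarrow> real \<Rightarrow> real \<Rightarrow> real \<Rightarrow> real \<Rightarrow> real \<Rightarrow>
   nat set \<Rightarrow> real ^ 'p \<Rightarrow> real ^ 'p \<Rightarrow> real \<Rightarrow> real ^ 'p \<Rightarrow> bool" where
  "ridge_newton_step n f lam \<theta>\<^sub>1 \<theta>\<^sub>2 \<beta> \<alpha>max S x p \<alpha> y \<longleftrightarrow>
     inexact_direction (ridge_hessian f lam S x) (gradient (average_fun n f) x) \<theta>\<^sub>1 \<theta>\<^sub>2 p \<and>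
     line_search_step (average_fun n f) \<beta> \<alpha>max x p \<alpha> \<and>
     y = x + \<alpha> *\<^sub>R p"

end

theory Submission
  imports Defs
begin

text \<open>The only randomness is in the smallest eigenvalue of the sampled Hessian. If it is at least
  \<open>(1 - \<epsilon>) \<gamma>\<close>, the regularized Hessian lies between \<open>m = (1 - \<epsilon>) \<gamma> + \<lambda>\<close> and
  \<open>M = Khat n K s + \<lambda>\<close>; the inexactness condition then gives \<open>p \<bullet> g \<le> - |g|\<^sup>2 / (2 M)\<close>, which with
  strong convexity yields the contraction, and second-order Taylor expansion bounds the step size.

  The eigenvalue estimate is a matrix Chernoff bound. By a Klein-type inequality,
  \<open>tr exp (A - Y) \<le> tr exp A - (1 - D / 2) tr (Y exp A)\<close> whenever \<open>0 \<le> Y \<le> D\<close>. Averaging over one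
  draw therefore multiplies \<open>tr exp\<close> by at most a fixed factor, without the Golden-Thompson
  inequality. Sampling without replacement is handled in the same induction: convexity of \<open>tr exp\<close>
  shows that the \<open>(m + 1)\<close>-st draw may be replaced by an independent one from the full population.\<close>

section \<open>Eigenbases of symmetric matrices\<close>

text \<open>A quadratic in \<open>t\<close> that vanishes at \<open>0\<close> and never becomes
  negative has a minimum there, so its slope at \<open>0\<close> is zero. This is the first-order
  optimality condition for the Rayleigh quotient below.\<close>

lemma linear_term_eq_zero:
  fixes c q :: real
  assumes "\<And>t. 0 \<le> 2 * t * c + t\<^sup>2 * q"
  shows "c = 0"
proof -
  have q: "0 \<le> q"
    using assms[of 1] assms[of "-1"] by simp
  \<comment> \<open>The natural test point \<open>- c / q\<close> fails for \<open>q = 0\<close>.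
    Shifting the denominator by one avoids this and still makes the quadratic negative unless
    \<open>c = 0\<close>.\<close>
  define u where "u = c / (q + 1)"
  have c: "c = u * (q + 1)"
    using q by (simp add: u_def)
  have "2 * (- u) * c + (- u)\<^sup>2 * q = - (u\<^sup>2 * (q + 2))"
    by (simp add: c algebra_simps power2_eq_square)
  then have "u\<^sup>2 * (q + 2) \<le> 0"
    using assms[of "- u"] by linarith
  then show ?thesis
    using q by (simp add: mult_le_0_iff c)
qed

text \<open>A maximizer of the Rayleigh quotient on the compact unit sphere of \<open>S\<close> is
  an eigenvector: varying it in the direction of its own residual \<open>m v - T v\<close>, which
  stays in \<open>S\<close>, forces that residual to vanish.\<close>

lemma selfadjoint_eigenvector:
  fixes T :: "'a::euclidean_space \<Rightarrow> 'a"
  assumes T: "linear T" and sa: "\<And>x y. T x \<bullet> y = x \<bullet> T y"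
    and S: "subspace S" "T ` S \<subseteq> S" "S \<noteq> {0}"
  obtains v where "v \<in> S" "norm v = 1" "T v = (v \<bullet> T v) *\<^sub>R v"
proof -
  interpret T: linear T by fact
  let ?C = "S \<inter> sphere 0 1"
  obtain x where x: "x \<in> S" "x \<noteq> 0"
    using S subspace_0[OF S(1)] by auto
  then have "x /\<^sub>R norm x \<in> ?C"
    using S(1) by (simp add: subspace_scale)
  moreover have "compact ?C"
    by (simp add: closed_Int_compact closed_subspace S(1))
  moreover have "continuous_on ?C (\<lambda>v. v \<bullet> T v)"
    by (intro continuous_intros linear_continuous_on linear_conv_bounded_linear[THEN iffD1] T)
  ultimately obtain v where v: "v \<in> ?C" and max: "\<And>w. w \<in> ?C \<Longrightarrow> w \<bullet> T w \<le> v \<bullet> T v"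
    using continuous_attains_sup[of ?C "\<lambda>v. v \<bullet> T v"] by blast
  define m where "m = v \<bullet> T v"
  have vv: "v \<bullet> v = 1"
    using v by (simp add: dot_square_norm)
  have Q: "w \<bullet> T w \<le> m * (w \<bullet> w)" if "w \<in> S" for w
  proof (cases "w = 0")
    case False
    have "(w /\<^sub>R norm w) \<bullet> T (w /\<^sub>R norm w) \<le> m"
      unfolding m_def using that False S(1) by (intro max) (simp add: subspace_scale)
    then have "(w \<bullet> T w) / (norm w)\<^sup>2 \<le> m"
      by (simp add: T.scale power2_eq_square divide_inverse mult_ac)
    then show ?thesis
      using False by (simp add: divide_le_eq power2_norm_eq_inner)
  qed simp
  define w where "w = m *\<^sub>R v - T v"
  have w: "w \<in> S"
    unfolding w_def using v S by (intro subspace_diff subspace_scale) auto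
  \<comment> \<open>This is \<open>Q\<close> at \<open>v + t w\<close>. The constant term cancels
    because \<open>v\<close> attains the maximum \<open>m\<close>.\<close>
  have "0 \<le> 2 * t * (w \<bullet> w) + t\<^sup>2 * (m * (w \<bullet> w) - w \<bullet> T w)" for t
  proof -
    have "v + t *\<^sub>R w \<in> S"
      using v w S by (intro subspace_add subspace_scale) auto
    from Q[OF this] have "0 \<le> m * ((v + t *\<^sub>R w) \<bullet> (v + t *\<^sub>R w)) - (v + t *\<^sub>R w) \<bullet> T (v + t *\<^sub>R w)"
      by simp
    also have "\<dots> = 2 * t * (w \<bullet> (m *\<^sub>R v) - w \<bullet> T v) + t\<^sup>2 * (m * (w \<bullet> w) - w \<bullet> T w)"
      using sa[of v w] vv
      by (simp add: T.add T.scale inner_add_left inner_add_right m_def[symmetric]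
          inner_commute[of v w] inner_commute[of "T v"] power2_eq_square algebra_simps)
    also have "w \<bullet> (m *\<^sub>R v) - w \<bullet> T v = w \<bullet> w"
      unfolding inner_diff_right[symmetric] by (simp add: w_def)
    finally show ?thesis .
  qed
  then have "w \<bullet> w = 0"
    by (rule linear_term_eq_zero)
  then have "T v = (v \<bullet> T v) *\<^sub>R v"
    by (simp add: w_def m_def)
  then show thesis
    using that[of v] v by simp
qed

text \<open>Induction on the dimension: split off one eigenvector \<open>v\<close>. Self-adjointness
  makes the orthogonal complement of \<open>v\<close> in \<open>S\<close> invariant, so the
  induction hypothesis applies to it.\<close>

lemma selfadjoint_spectral_subspace:
  fixes T :: "'a::euclidean_space \<Rightarrow> 'a"
  assumes T: "linear T" and sa: "\<And>x y. T x \<bullet> y = x \<bullet> T y"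
    and S: "subspace S" "T ` S \<subseteq> S"
  shows "\<exists>B \<subseteq> S. pairwise orthogonal B \<and> (\<forall>v\<in>B. norm v = 1) \<and> span B = S \<and>
    (\<forall>v\<in>B. T v = (v \<bullet> T v) *\<^sub>R v)"
  using S
proof (induction "dim S" arbitrary: S rule: less_induct)
  case less
  show ?case
  proof (cases "S = {0}")
    case True
    then show ?thesis by (intro exI[of _ "{}"]) auto
  next
    case False
    obtain v where v: "v \<in> S" "norm v = 1" "T v = (v \<bullet> T v) *\<^sub>R v"
      using selfadjoint_eigenvector[OF T sa less.prems False] by blast
    have vv: "v \<bullet> v = 1"
      using v by (simp add: dot_square_norm)
    define S' where "S' = S \<inter> {y. v \<bullet> y = 0}"
    have S': "subspace S'"
      unfolding S'_def using less.prems(1) subspace_hyperplane[of v] by (intro subspace_inter) auto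
    have inv: "T ` S' \<subseteq> S'"
    proof
      fix z assume "z \<in> T ` S'"
      then obtain y where y: "z = T y" "y \<in> S" "v \<bullet> y = 0"
        by (auto simp: S'_def)
      have "v \<bullet> T y = T v \<bullet> y"
        by (simp add: sa)
      also have "\<dots> = (v \<bullet> T v) * (v \<bullet> y)"
        by (subst v(3)) simp
      finally have "v \<bullet> T y = (v \<bullet> T v) * (v \<bullet> y)" .
      then show "z \<in> S'"
        using y less.prems by (auto simp: S'_def)
    qed
    have "v \<notin> S'"
      using vv by (simp add: S'_def)
    moreover have "S' \<subseteq> S"
      by (simp add: S'_def)
    ultimately have "S' \<subset> S"
      using v(1) by blast
    then have "dim S' < dim S"
      using S' less.prems(1) by (metis dim_psubset span_eq_iff)
    then obtain B where B: "B \<subseteq> S'" "pairwise orthogonal B" "\<forall>v\<in>B. norm v = 1" "span B = S'"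
      "\<forall>v\<in>B. T v = (v \<bullet> T v) *\<^sub>R v"
      using less.hyps[OF _ S' inv] by blast
    have "span (insert v B) = S"
    proof
      show "span (insert v B) \<subseteq> S"
        using v B(1) less.prems(1) by (intro span_minimal) (auto simp: S'_def)
    next
      show "S \<subseteq> span (insert v B)"
      proof
        fix x assume x: "x \<in> S"
        have "x - (v \<bullet> x) *\<^sub>R v \<in> S'"
          using x v(1) vv less.prems(1)
          by (auto simp: S'_def inner_diff_right intro!: subspace_diff subspace_scale)
        then show "x \<in> span (insert v B)"
          unfolding span_insert B(4) by blast
      qed
    qed
    moreover have "pairwise orthogonal (insert v B)"
      using B(1,2) by (auto simp: pairwise_insert S'_def orthogonal_def inner_commute)
    ultimately show ?thesis
      using B v by (intro exI[of _ "insert v B"]) (auto simp: S'_def)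
  qed
qed

definition orthonormal_basis :: "'a::euclidean_space set \<Rightarrow> bool" where
  "orthonormal_basis B \<longleftrightarrow> pairwise orthogonal B \<and> (\<forall>v\<in>B. norm v = 1) \<and> span B = UNIV"

lemma orthonormal_basis_finite: "orthonormal_basis B \<Longrightarrow> finite B"
  by (simp add: orthonormal_basis_def pairwise_orthogonal_imp_finite)

lemma orthonormal_basis_norm: "orthonormal_basis B \<Longrightarrow> v \<in> B \<Longrightarrow> v \<bullet> v = 1"
  by (simp add: orthonormal_basis_def dot_square_norm)

lemma orthonormal_basis_card:
  assumes "orthonormal_basis (B :: 'a::euclidean_space set)"
  shows "card B = DIM('a)"
proof -
  have "0 \<notin> B"
    using assms orthonormal_basis_norm by fastforce
  then have "independent B"
    using assms by (simp add: orthonormal_basis_def pairwise_orthogonal_independent)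
  then show ?thesis
    using assms by (metis dim_UNIV dim_eq_card_independent dim_span orthonormal_basis_def)
qed

lemma orthonormal_basis_parseval:
  assumes "orthonormal_basis B"
  shows "(\<Sum>u\<in>B. (u \<bullet> x) * (u \<bullet> y)) = x \<bullet> y"
proof -
  have "x \<bullet> y = (\<Sum>u\<in>B. (x \<bullet> u) *\<^sub>R u) \<bullet> y"
    using assms orthonormal_basis_finite[OF assms]
    by (subst orthonormal_basis_expand) (auto simp: orthonormal_basis_def)
  also have "\<dots> = (\<Sum>u\<in>B. (u \<bullet> x) * (u \<bullet> y))"
    by (simp add: inner_sum_left inner_commute[of x])
  finally show ?thesis ..
qed

lemma orthonormal_basis_parseval_norm:
  assumes "orthonormal_basis B"
  shows "(\<Sum>u\<in>B. (u \<bullet> x)\<^sup>2) = x \<bullet> x"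
  using orthonormal_basis_parseval[OF assms, of x x] by (simp add: power2_eq_square)

text \<open>Eigenvalues are written as Rayleigh quotients of the basis vectors, so that no separate
  eigenvalue function has to be carried along and multiplicities are counted automatically.\<close>

definition eigenbasis :: "real ^ 'n ^ 'n \<Rightarrow> (real ^ 'n) set \<Rightarrow> bool" where
  "eigenbasis A B \<longleftrightarrow> orthonormal_basis B \<and> (\<forall>v\<in>B. A *v v = (v \<bullet> (A *v v)) *\<^sub>R v)"

lemma inner_symmetric_matrix:
  fixes A :: "real ^ 'n ^ 'n"
  assumes "transpose A = A"
  shows "(A *v x) \<bullet> y = x \<bullet> (A *v y)"
  by (metis assms dot_lmul_matrix vector_transpose_matrix)

lemma symmetric_eigenbasis:
  assumes "transpose A = A"
  shows "\<exists>B. eigenbasis A B"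
  using selfadjoint_spectral_subspace[of "(*v) A" UNIV] inner_symmetric_matrix[OF assms]
  by (auto simp: eigenbasis_def orthonormal_basis_def)

section \<open>The trace of the matrix exponential\<close>

lemma eigenbasis_inner:
  assumes "transpose A = A" "eigenbasis A B" "u \<in> B"
  shows "u \<bullet> (A *v x) = (u \<bullet> (A *v u)) * (u \<bullet> x)"
proof -
  have "u \<bullet> (A *v x) = (A *v u) \<bullet> x"
    by (simp add: inner_symmetric_matrix assms(1))
  also have "\<dots> = (u \<bullet> (A *v u)) * (u \<bullet> x)"
    using assms(2,3) by (metis eigenbasis_def inner_scaleR_left)
  finally show ?thesis .
qed

lemma eigenbasis_quadratic_form:
  assumes "transpose A = A" "eigenbasis A B"
  shows "x \<bullet> (A *v x) = (\<Sum>u\<in>B. (u \<bullet> x)\<^sup>2 * (u \<bullet> (A *v u)))"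
proof -
  have "orthonormal_basis B"
    using assms(2) by (simp add: eigenbasis_def)
  then have "x \<bullet> (A *v x) = (\<Sum>u\<in>B. (u \<bullet> x) * (u \<bullet> (A *v x)))"
    by (simp add: orthonormal_basis_parseval)
  also have "\<dots> = (\<Sum>u\<in>B. (u \<bullet> x)\<^sup>2 * (u \<bullet> (A *v u)))"
    using assms by (intro sum.cong) (simp_all add: eigenbasis_inner[of A B _ x] power2_eq_square)
  finally show ?thesis .
qed

text \<open>For a matrix that is not symmetric, \<open>SOME\<close> picks an arbitrary set and \<open>trace_exp\<close> below
  is meaningless.\<close>

definition eigenvectors :: "real ^ 'n ^ 'n \<Rightarrow> (real ^ 'n) set" where
  "eigenvectors A = (SOME B. eigenbasis A B)"

text \<open>For symmetric \<open>A\<close> this is tr exp A as the sum of the exponentials of the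
  eigenvalues; the matrix exponential itself is never formed.\<close>

definition trace_exp :: "real ^ 'n ^ 'n \<Rightarrow> real" where
  "trace_exp A = (\<Sum>v\<in>eigenvectors A. exp (v \<bullet> (A *v v)))"

lemma eigenbasis_eigenvectors: "transpose A = A \<Longrightarrow> eigenbasis A (eigenvectors A)"
  unfolding eigenvectors_def by (rule someI_ex) (rule symmetric_eigenbasis)

lemma orthonormal_basis_eigenvectors: "transpose A = A \<Longrightarrow> orthonormal_basis (eigenvectors A)"
  using eigenbasis_eigenvectors by (auto simp: eigenbasis_def)

lemma trace_exp_nonneg: "0 \<le> trace_exp A"
  by (simp add: trace_exp_def sum_nonneg)

lemma trace_exp_zero: "trace_exp (0 :: real ^ 'n ^ 'n) = real CARD('n)"
proof -
  have "transpose (0 :: real ^ 'n ^ 'n) = 0"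
    by (simp add: transpose_def vec_eq_iff)
  then show ?thesis
    by (simp add: trace_exp_def orthonormal_basis_card orthonormal_basis_eigenvectors)
qed

text \<open>By Parseval the weights \<open>(u \<bullet> v)\<^sup>2\<close> sum to one, and the
  quadratic form at \<open>v\<close> is the corresponding mean of the eigenvalues; the claim is
  Jensen's inequality for \<open>exp\<close>.\<close>

lemma exp_quadratic_form_le_weighted:
  assumes A: "transpose A = A" and v: "v \<bullet> v = 1"
  shows "exp (v \<bullet> (A *v v)) \<le> (\<Sum>u\<in>eigenvectors A. (u \<bullet> v)\<^sup>2 * exp (u \<bullet> (A *v u)))"
proof -
  let ?U = "eigenvectors A"
  have 1: "(\<Sum>u\<in>?U. (u \<bullet> v)\<^sup>2) = 1"
    using orthonormal_basis_parseval_norm[OF orthonormal_basis_eigenvectors[OF A]] v by simp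
  then have "?U \<noteq> {}"
    by auto
  moreover have "finite ?U"
    by (intro orthonormal_basis_finite orthonormal_basis_eigenvectors A)
  ultimately have "exp (\<Sum>u\<in>?U. (u \<bullet> v)\<^sup>2 *\<^sub>R (u \<bullet> (A *v u))) \<le> (\<Sum>u\<in>?U. (u \<bullet> v)\<^sup>2 * exp (u \<bullet> (A *v u)))"
    using 1 by (intro convex_on_sum[OF _ _ exp_convex]) auto
  then show ?thesis
    by (simp add: eigenbasis_quadratic_form[OF A eigenbasis_eigenvectors[OF A], of v])
qed

text \<open>Each weight is at most one by Cauchy-Schwarz. In the tail bound this turns a single bad
  direction into a lower bound on the trace.\<close>

lemma exp_quadratic_form_le_trace_exp:
  assumes A: "transpose A = A" and v: "v \<bullet> v = 1"
  shows "exp (v \<bullet> (A *v v)) \<le> trace_exp A"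
proof -
  have "(\<Sum>u\<in>eigenvectors A. (u \<bullet> v)\<^sup>2 * exp (u \<bullet> (A *v u))) \<le> trace_exp A"
    unfolding trace_exp_def
  proof (rule sum_mono)
    fix u assume "u \<in> eigenvectors A"
    then have "u \<bullet> u = 1"
      using A orthonormal_basis_eigenvectors orthonormal_basis_norm by blast
    then have "(u \<bullet> v)\<^sup>2 \<le> 1"
      using Cauchy_Schwarz_ineq[of u v] v by simp
    then show "(u \<bullet> v)\<^sup>2 * exp (u \<bullet> (A *v u)) \<le> exp (u \<bullet> (A *v u))"
      by (simp add: mult_left_le_one_le)
  qed
  then show ?thesis
    using exp_quadratic_form_le_weighted[OF assms] by linarith
qed

text \<open>The weights between two orthonormal bases form a doubly stochastic matrix: the row sums
  give Jensen, the column sums collapse the double sum to the trace.\<close>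

lemma peierls_inequality:
  assumes A: "transpose A = A" and V: "orthonormal_basis V"
  shows "(\<Sum>v\<in>V. exp (v \<bullet> (A *v v))) \<le> trace_exp A"
proof -
  let ?U = "eigenvectors A"
  have "(\<Sum>v\<in>V. exp (v \<bullet> (A *v v))) \<le> (\<Sum>v\<in>V. \<Sum>u\<in>?U. (u \<bullet> v)\<^sup>2 * exp (u \<bullet> (A *v u)))"
    by (intro sum_mono exp_quadratic_form_le_weighted A orthonormal_basis_norm[OF V])
  also have "\<dots> = (\<Sum>u\<in>?U. (\<Sum>v\<in>V. (v \<bullet> u)\<^sup>2) * exp (u \<bullet> (A *v u)))"
    by (subst sum.swap) (simp add: sum_distrib_right inner_commute)
  also have "\<dots> = (\<Sum>u\<in>?U. exp (u \<bullet> (A *v u)))"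
    using orthonormal_basis_norm[OF orthonormal_basis_eigenvectors[OF A]]
    by (intro sum.cong) (simp_all add: orthonormal_basis_parseval_norm[OF V])
  finally show ?thesis
    by (simp add: trace_exp_def)
qed

lemma transpose_sum: "transpose (sum A I) = (\<Sum>i\<in>I. transpose (A i))"
  by (simp add: transpose_def vec_eq_iff sum_component)

lemma matrix_vector_mult_sum: "sum A I *v (x :: real ^ 'n) = (\<Sum>i\<in>I. A i *v x)"
  by (induction I rule: infinite_finite_induct) (simp_all add: matrix_vector_mult_add_rdistrib)

text \<open>Convexity of the trace exponential: scalar Jensen in an eigenbasis of the mean
  \<open>C\<close>, then Peierls for every \<open>A i\<close> in that same basis.\<close>

lemma trace_exp_jensen:
  assumes I: "finite I" "I \<noteq> {}" and A: "\<And>i. i \<in> I \<Longrightarrow> transpose (A i) = A i"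
    and C: "real (card I) *\<^sub>R C = (\<Sum>i\<in>I. A i)"
  shows "real (card I) * trace_exp C \<le> (\<Sum>i\<in>I. trace_exp (A i))"
proof -
  define w where "w = 1 / real (card I)"
  have cI: "real (card I) > 0"
    using I by (simp add: card_gt_0_iff)
  have Cw: "C = w *\<^sub>R (\<Sum>i\<in>I. A i)"
    using cI by (simp add: C[symmetric] w_def)
  have symC: "transpose C = C"
    unfolding Cw using A by (simp add: transpose_scalar transpose_sum)
  let ?V = "eigenvectors C"
  have V: "orthonormal_basis ?V"
    by (rule orthonormal_basis_eigenvectors[OF symC])
  have "exp (v \<bullet> (C *v v)) \<le> (\<Sum>i\<in>I. w * exp (v \<bullet> (A i *v v)))" for v
  proof -
    have "exp (\<Sum>i\<in>I. w *\<^sub>R (v \<bullet> (A i *v v))) \<le> (\<Sum>i\<in>I. w * exp (v \<bullet> (A i *v v)))"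
      using I cI by (intro convex_on_sum[OF _ _ exp_convex]) (auto simp: w_def)
    then show ?thesis
      by (simp add: Cw scaleR_matrix_vector_assoc[symmetric] matrix_vector_mult_sum
          inner_sum_right sum_distrib_left)
  qed
  then have "trace_exp C \<le> (\<Sum>v\<in>?V. \<Sum>i\<in>I. w * exp (v \<bullet> (A i *v v)))"
    unfolding trace_exp_def by (intro sum_mono)
  also have "\<dots> = (\<Sum>i\<in>I. w * (\<Sum>v\<in>?V. exp (v \<bullet> (A i *v v))))"
    by (subst sum.swap) (simp add: sum_distrib_left)
  also have "\<dots> \<le> (\<Sum>i\<in>I. w * trace_exp (A i))"
    using A V by (intro sum_mono mult_left_mono peierls_inequality) (auto simp: w_def)
  finally have "trace_exp C \<le> (\<Sum>i\<in>I. trace_exp (A i)) / real (card I)"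
    by (simp add: w_def sum_divide_distrib)
  then show ?thesis
    using cI by (simp add: pos_le_divide_eq mult.commute)
qed

section \<open>A Klein-type inequality for the trace exponential\<close>

text \<open>On eigenvalues \<open>l\<close> of \<open>Y\<close> this is
  \<open>l * l \<le> D * l\<close>, valid since \<open>0 \<le> l \<le> D\<close>. It reduces
  second-order terms in \<open>Y\<close> to first-order ones.\<close>

lemma psd_norm_square_le:
  fixes Y :: "real ^ 'n ^ 'n"
  assumes Y: "transpose Y = Y" and "\<And>v. 0 \<le> v \<bullet> (Y *v v)" and "\<And>v. v \<bullet> (Y *v v) \<le> D * (v \<bullet> v)"
  shows "(Y *v x) \<bullet> (Y *v x) \<le> D * (x \<bullet> (Y *v x))"
proof -
  let ?W = "eigenvectors Y"
  have W: "orthonormal_basis ?W" "eigenbasis Y ?W"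
    by (simp_all add: Y eigenbasis_eigenvectors orthonormal_basis_eigenvectors)
  have "(Y *v x) \<bullet> (Y *v x) = (\<Sum>w\<in>?W. (w \<bullet> x)\<^sup>2 * ((w \<bullet> (Y *v w)) * (w \<bullet> (Y *v w))))"
    unfolding orthonormal_basis_parseval_norm[OF W(1), symmetric]
    using W by (intro sum.cong) (simp_all add: eigenbasis_inner[OF Y W(2), of _ x] power2_eq_square)
  also have "\<dots> \<le> (\<Sum>w\<in>?W. (w \<bullet> x)\<^sup>2 * (D * (w \<bullet> (Y *v w))))"
  proof (intro sum_mono mult_left_mono mult_right_mono)
    fix w assume "w \<in> ?W"
    then show "w \<bullet> (Y *v w) \<le> D"
      using assms(3)[of w] orthonormal_basis_norm[OF W(1)] by simp
  qed (simp_all add: assms)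
  also have "\<dots> = D * (x \<bullet> (Y *v x))"
    by (simp add: eigenbasis_quadratic_form[OF Y W(2), of x] sum_distrib_left mult_ac)
  finally show ?thesis .
qed

text \<open>The weights \<open>1/3\<close> and \<open>1/6\<close> are the ones for which the expansions at \<open>0\<close> agree to third
  order, so that the inequality holds for \<open>d\<close> of either sign. This is needed since differences of
  eigenvalues of \<open>A\<close> and \<open>A - Y\<close> can be negative even when \<open>Y\<close> is positive semi-definite.\<close>

lemma exp_taylor_weighted:
  fixes d :: real
  shows "0 \<le> exp d * (1 - d + d\<^sup>2 / 3) - 1 + d\<^sup>2 / 6"
proof -
  define k where "k = (\<lambda>d::real. exp d * (1 - d + d\<^sup>2 / 3) - 1 + d\<^sup>2 / 6)"
  \<comment> \<open>The factor in parentheses is nonnegative, so the derivative has the sign of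
    \<open>t\<close> and \<open>k\<close> is minimal at \<open>0\<close>, where it vanishes.\<close>
  have deriv: "(k has_real_derivative (t / 3 * (exp t * (t - 1) + 1))) (at t)" for t
    unfolding k_def by (auto intro!: derivative_eq_intros simp: field_simps power2_eq_square)
  have pos: "0 \<le> exp t * (t - 1) + 1" for t :: real
  proof -
    have "exp t * (1 - t) \<le> exp t * exp (- t)"
      using exp_ge_add_one_self[of "- t"] by (intro mult_left_mono) auto
    then show ?thesis
      by (simp add: exp_minus algebra_simps)
  qed
  have "k 0 \<le> k d"
  proof (cases "0 \<le> d")
    case True
    have "\<exists>y. DERIV k t :> y \<and> 0 \<le> y" if "0 \<le> t" for t
      using deriv[of t] pos[of t] that
      by (intro exI[of _ "t / 3 * (exp t * (t - 1) + 1)"]) simp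
    then show ?thesis
      by (intro DERIV_nonneg_imp_nondecreasing[OF True]) auto
  next
    case False
    have "\<exists>y. DERIV k t :> y \<and> y \<le> 0" if "t \<le> 0" for t
      using deriv[of t] pos[of t] that
      by (intro exI[of _ "t / 3 * (exp t * (t - 1) + 1)"]) (auto intro!: mult_nonpos_nonneg divide_nonpos_nonneg)
    then show ?thesis
      using False by (intro DERIV_nonpos_imp_nonincreasing[of d 0]) auto
  qed
  then show ?thesis
    by (simp add: k_def)
qed

text \<open>The preceding inequality at \<open>d = a - b\<close>, multiplied by
  \<open>exp b\<close>. Every term is now a function of \<open>a\<close> and \<open>b\<close> of the
  kind that lifts to traces.\<close>

lemma exp_diff_le_weighted:
  fixes a b :: real
  shows "exp b \<le> exp a - exp a * (a - b) + exp a * (a - b)\<^sup>2 / 3 + exp b * (a - b)\<^sup>2 / 6"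
proof -
  have "0 \<le> exp b * (exp (a - b) * (1 - (a - b) + (a - b)\<^sup>2 / 3) - 1 + (a - b)\<^sup>2 / 6)"
    using exp_taylor_weighted[of "a - b"] by (intro mult_nonneg_nonneg) auto
  also have "\<dots> = exp a * (1 - (a - b) + (a - b)\<^sup>2 / 3) - exp b + exp b * (a - b)\<^sup>2 / 6"
    by (simp add: exp_diff algebra_simps)
  finally show ?thesis
    by (simp add: algebra_simps)
qed

lemma transpose_add: "transpose (A + B) = transpose A + transpose (B :: 'a::ab_group_add ^ 'n ^ 'm)"
  by (simp add: transpose_def vec_eq_iff)

lemma transpose_diff: "transpose (A - B) = transpose A - transpose (B :: 'a::ab_group_add ^ 'n ^ 'm)"
  by (simp add: transpose_def vec_eq_iff)

text \<open>Any scalar inequality between sums of products \<open>g(a) h(b)\<close> lifts to traces: all traces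
  involved are the sums \<open>S\<close> below, over pairs of eigenvectors \<open>v\<close> of \<open>A\<close> and \<open>u\<close> of \<open>A - Y\<close>, with
  the same weights \<open>(u \<bullet> v)\<^sup>2\<close>.\<close>

lemma trace_exp_diff_le:
  fixes A Y :: "real ^ 'n ^ 'n"
  assumes A: "transpose A = A" and Y: "transpose Y = Y" and D: "0 \<le> D"
    and Y0: "\<And>v. 0 \<le> v \<bullet> (Y *v v)" and YD: "\<And>v. v \<bullet> (Y *v v) \<le> D * (v \<bullet> v)"
  shows "trace_exp (A - Y) \<le> trace_exp A
    - (1 - D / 2) * (\<Sum>v\<in>eigenvectors A. exp (v \<bullet> (A *v v)) * (v \<bullet> (Y *v v)))"
proof -
  define V where "V = eigenvectors A"
  define U where "U = eigenvectors (A - Y)"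
  define a where "a v = v \<bullet> (A *v v)" for v
  define b where "b v = v \<bullet> ((A - Y) *v v)" for v
  define S where "S g = (\<Sum>v\<in>V. \<Sum>u\<in>U. (u \<bullet> v)\<^sup>2 * g (a v) (b u))" for g :: "real \<Rightarrow> real \<Rightarrow> real"
  have B: "transpose (A - Y) = A - Y"
    by (simp add: transpose_diff A Y)
  have V: "orthonormal_basis V" "eigenbasis A V" and U: "orthonormal_basis U" "eigenbasis (A - Y) U"
    by (simp_all add: V_def U_def A B eigenbasis_eigenvectors orthonormal_basis_eigenvectors)
  \<comment> \<open>Entries of \<open>Y = A - (A - Y)\<close> between the two eigenbases:
    \<open>A\<close> acts on \<open>v\<close> by \<open>a v\<close>, and \<open>A - Y\<close> acts
    on \<open>u\<close> by \<open>b u\<close>.\<close>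
  have cross: "u \<bullet> (Y *v v) = (a v - b u) * (u \<bullet> v)" "v \<bullet> (Y *v u) = (a v - b u) * (u \<bullet> v)"
    if "u \<in> U" "v \<in> V" for u v
  proof -
    have "u \<bullet> (Y *v v) = (A *v u) \<bullet> v - u \<bullet> ((A - Y) *v v)"
      by (simp add: inner_symmetric_matrix[OF A] matrix_vector_mult_diff_rdistrib inner_diff_right)
    also have "\<dots> = (a v - b u) * (u \<bullet> v)"
      using eigenbasis_inner[OF B U(2) that(1), of v] eigenbasis_inner[OF A V(2) that(2), of u]
      by (simp add: a_def b_def inner_commute algebra_simps)
    finally show "u \<bullet> (Y *v v) = (a v - b u) * (u \<bullet> v)" .
    then show "v \<bullet> (Y *v u) = (a v - b u) * (u \<bullet> v)"
      using inner_symmetric_matrix[OF Y, of v u] by (simp add: inner_commute)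
  qed
  have Yv: "v \<bullet> (Y *v v) = (\<Sum>u\<in>U. (u \<bullet> v)\<^sup>2 * (a v - b u))"
    "(Y *v v) \<bullet> (Y *v v) = (\<Sum>u\<in>U. (u \<bullet> v)\<^sup>2 * (a v - b u)\<^sup>2)" if "v \<in> V" for v
    using that orthonormal_basis_parseval[OF U(1), of v "Y *v v", symmetric]
      orthonormal_basis_parseval_norm[OF U(1), of "Y *v v", symmetric]
    by (simp_all add: cross power2_eq_square mult_ac)
  have Yu: "u \<bullet> (Y *v u) = (\<Sum>v\<in>V. (u \<bullet> v)\<^sup>2 * (a v - b u))"
    "(Y *v u) \<bullet> (Y *v u) = (\<Sum>v\<in>V. (u \<bullet> v)\<^sup>2 * (a v - b u)\<^sup>2)" if "u \<in> U" for u
    using that orthonormal_basis_parseval[OF V(1), of u "Y *v u", symmetric]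
      orthonormal_basis_parseval_norm[OF V(1), of "Y *v u", symmetric]
    by (simp_all add: cross power2_eq_square inner_commute mult_ac)
  have Sleft: "(\<Sum>v\<in>V. exp (a v) * (\<Sum>u\<in>U. (u \<bullet> v)\<^sup>2 * h (a v) (b u))) = S (\<lambda>x y. exp x * h x y)"
    and Sright: "(\<Sum>u\<in>U. exp (b u) * (\<Sum>v\<in>V. (u \<bullet> v)\<^sup>2 * h (a v) (b u))) = S (\<lambda>x y. exp y * h x y)" for h
    unfolding S_def sum_distrib_left by (simp add: mult_ac, subst sum.swap, simp add: mult_ac)
  have one: "(\<Sum>u\<in>U. (u \<bullet> v)\<^sup>2) = 1" if "v \<in> V" for v
    using that by (simp add: orthonormal_basis_parseval_norm[OF U(1)] orthonormal_basis_norm[OF V(1)])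
  have one': "(\<Sum>v\<in>V. (u \<bullet> v)\<^sup>2) = 1" if "u \<in> U" for u
    using that orthonormal_basis_parseval_norm[OF V(1), of u]
    by (simp add: orthonormal_basis_norm[OF U(1)] inner_commute)
  have TA: "trace_exp A = S (\<lambda>x y. exp x)"
    using Sleft[of "\<lambda>_ _. 1"] one by (simp add: trace_exp_def V_def[symmetric] a_def[symmetric])
  have TB: "trace_exp (A - Y) = S (\<lambda>x y. exp y)"
    using Sright[of "\<lambda>_ _. 1"] one' by (simp add: trace_exp_def U_def[symmetric] b_def[symmetric])
  \<comment> \<open>These four are tr (Y exp A), tr (Y^2 exp A), tr (Y exp (A - Y)) and tr (Y^2 exp
    (A - Y)), each evaluated in an eigenbasis of the exponent.\<close>
  define A1 where "A1 = (\<Sum>v\<in>V. exp (a v) * (v \<bullet> (Y *v v)))"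
  define A2 where "A2 = (\<Sum>v\<in>V. exp (a v) * ((Y *v v) \<bullet> (Y *v v)))"
  define B1 where "B1 = (\<Sum>u\<in>U. exp (b u) * (u \<bullet> (Y *v u)))"
  define B2 where "B2 = (\<Sum>u\<in>U. exp (b u) * ((Y *v u) \<bullet> (Y *v u)))"
  have A1: "A1 = S (\<lambda>x y. exp x * (x - y))" and A2: "A2 = S (\<lambda>x y. exp x * (x - y)\<^sup>2)"
    using Sleft[of "\<lambda>x y. x - y"] Sleft[of "\<lambda>x y. (x - y)\<^sup>2"] by (simp_all add: A1_def A2_def Yv)
  have B1: "B1 = S (\<lambda>x y. exp y * (x - y))" and B2: "B2 = S (\<lambda>x y. exp y * (x - y)\<^sup>2)"
    using Sright[of "\<lambda>x y. x - y"] Sright[of "\<lambda>x y. (x - y)\<^sup>2"] by (simp_all add: B1_def B2_def Yu)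
  have mono: "S g \<le> S h" if "\<And>x y. g x y \<le> h x y" for g h
    unfolding S_def by (intro sum_mono mult_left_mono that) simp
  have "S (\<lambda>x y. exp y) \<le> S (\<lambda>x y. exp x - exp x * (x - y) + exp x * (x - y)\<^sup>2 / 3 + exp y * (x - y)\<^sup>2 / 6)"
    by (intro mono exp_diff_le_weighted)
  also have "\<dots> = S (\<lambda>x y. exp x) - A1 + A2 / 3 + B2 / 6"
    by (simp add: A1 A2 B2 S_def sum.distrib sum_subtractf sum_divide_distrib algebra_simps)
  finally have klein: "trace_exp (A - Y) \<le> trace_exp A - A1 + A2 / 3 + B2 / 6"
    by (simp add: TA TB)
  \<comment> \<open>Monotonicity of \<open>exp\<close> allows tr (Y exp (A - Y)) to be replaced by
    tr (Y exp A).\<close>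
  have "exp y * (x - y) \<le> exp x * (x - y)" for x y :: real
    by (cases "x \<le> y") (auto intro: mult_right_mono mult_right_mono_neg)
  then have B1A1: "B1 \<le> A1"
    unfolding A1 B1 by (rule mono)
  have "A2 \<le> D * A1" "B2 \<le> D * B1"
    unfolding A1_def A2_def B1_def B2_def sum_distrib_left
    using psd_norm_square_le[OF Y Y0 YD] by (auto intro!: sum_mono simp: mult.left_commute)
  moreover have "D * B1 \<le> D * A1"
    using B1A1 D by (rule mult_left_mono)
  \<comment> \<open>The second-order terms add up to at most \<open>D / 3 + D / 6 = D / 2\<close>
    times \<open>A1\<close>.\<close>
  ultimately have "trace_exp (A - Y) \<le> trace_exp A - (1 - D / 2) * A1"
    using klein by (simp add: algebra_simps)
  then show ?thesis
    by (simp add: A1_def V_def a_def)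
qed

section \<open>A matrix Chernoff bound for sampling without replacement\<close>

text \<open>The effect of one uniform draw: the Klein-type inequality with
  \<open>Y = \<theta> X j\<close> and \<open>D = \<theta> L\<close> is linear in \<open>X j\<close>,
  so after summation over \<open>j\<close> only the lower bound on the mean enters. Finally
  \<open>1 - x \<le> exp (- x)\<close>.\<close>

lemma sum_trace_exp_step:
  fixes A :: "real ^ 'n ^ 'n"
  assumes A: "transpose A = A" and X: "\<And>j. j \<in> I \<Longrightarrow> transpose (X j) = X j"
    and X0: "\<And>j v. j \<in> I \<Longrightarrow> 0 \<le> v \<bullet> (X j *v v)"
    and XL: "\<And>j v. j \<in> I \<Longrightarrow> v \<bullet> (X j *v v) \<le> L * (v \<bullet> v)"
    and mean: "\<And>v. real (card I) * (\<gamma> * (v \<bullet> v)) \<le> (\<Sum>j\<in>I. v \<bullet> (X j *v v))"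
    and L: "0 \<le> L" and \<theta>: "0 \<le> \<theta>" "\<theta> * L \<le> 1"
  shows "(\<Sum>j\<in>I. trace_exp (A - \<theta> *\<^sub>R X j))
    \<le> real (card I) * (exp (- (\<theta> * (1 - \<theta> * L / 2) * \<gamma>)) * trace_exp A)"
proof -
  let ?V = "eigenvectors A" and ?a = "\<lambda>v. exp (v \<bullet> (A *v v))"
  let ?c = "\<theta> * (1 - \<theta> * L / 2)"
  have c: "0 \<le> ?c"
    using \<theta> by simp
  have quad: "v \<bullet> ((\<theta> *\<^sub>R X j) *v v) = \<theta> * (v \<bullet> (X j *v v))" for j v
    by (simp add: scaleR_matrix_vector_assoc[symmetric])
  have step: "trace_exp (A - \<theta> *\<^sub>R X j) \<le> trace_exp A - (\<Sum>v\<in>?V. ?c * (?a v * (v \<bullet> (X j *v v))))"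
    if j: "j \<in> I" for j
  proof -
    have "trace_exp (A - \<theta> *\<^sub>R X j) \<le> trace_exp A
      - (1 - \<theta> * L / 2) * (\<Sum>v\<in>?V. ?a v * (v \<bullet> ((\<theta> *\<^sub>R X j) *v v)))"
    proof (rule trace_exp_diff_le[OF A])
      show "v \<bullet> ((\<theta> *\<^sub>R X j) *v v) \<le> \<theta> * L * (v \<bullet> v)" for v
        unfolding quad mult.assoc using \<theta>(1) XL[OF j] by (rule mult_left_mono[rotated])
      show "0 \<le> v \<bullet> ((\<theta> *\<^sub>R X j) *v v)" for v
        unfolding quad using \<theta>(1) X0[OF j] by simp
    qed (use X j \<theta> L in \<open>simp_all add: transpose_scalar\<close>)
    then show ?thesis
      by (simp add: quad sum_distrib_left mult_ac)
  qed
  have "real (card I) * \<gamma> \<le> (\<Sum>j\<in>I. v \<bullet> (X j *v v))" if "v \<in> ?V" for v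
    using that mean[of v] orthonormal_basis_norm[OF orthonormal_basis_eigenvectors[OF A], of v] by simp
  then have "(\<Sum>v\<in>?V. ?c * (?a v * (real (card I) * \<gamma>))) \<le> (\<Sum>v\<in>?V. ?c * (?a v * (\<Sum>j\<in>I. v \<bullet> (X j *v v))))"
    using c by (intro sum_mono mult_left_mono) auto
  also have "\<dots> = (\<Sum>j\<in>I. \<Sum>v\<in>?V. ?c * (?a v * (v \<bullet> (X j *v v))))"
    by (subst sum.swap) (simp add: sum_distrib_left)
  finally have sum: "real (card I) * (?c * \<gamma> * trace_exp A) \<le> (\<Sum>j\<in>I. \<Sum>v\<in>?V. ?c * (?a v * (v \<bullet> (X j *v v))))"
    by (simp add: trace_exp_def sum_distrib_left mult_ac)
  have "(\<Sum>j\<in>I. trace_exp (A - \<theta> *\<^sub>R X j)) \<le> (\<Sum>j\<in>I. trace_exp A - (\<Sum>v\<in>?V. ?c * (?a v * (v \<bullet> (X j *v v)))))"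
    by (intro sum_mono step)
  also have "\<dots> = real (card I) * trace_exp A - (\<Sum>j\<in>I. \<Sum>v\<in>?V. ?c * (?a v * (v \<bullet> (X j *v v))))"
    by (simp add: sum_subtractf)
  also have "\<dots> \<le> real (card I) * ((1 - ?c * \<gamma>) * trace_exp A)"
    using sum by (simp add: algebra_simps)
  also have "\<dots> \<le> real (card I) * (exp (- (?c * \<gamma>)) * trace_exp A)"
    using exp_ge_add_one_self[of "- (?c * \<gamma>)"]
    by (intro mult_left_mono mult_right_mono trace_exp_nonneg) auto
  finally show ?thesis .
qed

section \<open>Sampling without replacement\<close>

text \<open>Double counting: an \<open>m\<close>-subset with a new element \<open>j\<close>
  corresponds to an \<open>(m + 1)\<close>-subset with a marked element \<open>j\<close>.\<close>

lemma sum_insert_eq_sum_remove: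
  assumes "finite I"
  shows "(\<Sum>S | S \<subseteq> I \<and> card S = m. \<Sum>j\<in>I - S. h S j)
    = (\<Sum>S | S \<subseteq> I \<and> card S = Suc m. \<Sum>j\<in>S. h (S - {j}) j)"
proof -
  have fin: "finite S" if "S \<subseteq> I" for S
    using that assms finite_subset by blast
  have "finite {S. S \<subseteq> I \<and> card S = k}" for k
    using assms by simp
  then have "(\<Sum>S | S \<subseteq> I \<and> card S = m. \<Sum>j\<in>I - S. h S j)
      = (\<Sum>(S, j)\<in>Sigma {S. S \<subseteq> I \<and> card S = m} (\<lambda>S. I - S). h S j)"
    using assms by (intro sum.Sigma) auto
  also have "\<dots> = (\<Sum>(S, j)\<in>Sigma {S. S \<subseteq> I \<and> card S = Suc m} (\<lambda>S. S). h (S - {j}) j)"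
    by (rule sum.reindex_bij_witness[of _ "\<lambda>(S, j). (S - {j}, j)" "\<lambda>(S, j). (insert j S, j)"])
      (auto simp: fin card_insert_if insert_absorb)
  also have "\<dots> = (\<Sum>S | S \<subseteq> I \<and> card S = Suc m. \<Sum>j\<in>S. h (S - {j}) j)"
    using assms fin by (intro sum.Sigma[symmetric]) auto
  finally show ?thesis .
qed

text \<open>Exchanging one element of \<open>S\<close> for a copy of another one leaves the sum over \<open>S\<close> unchanged on
  average, so Jensen's inequality applies.\<close>

lemma sum_trace_exp_exchange:
  fixes B :: "'i \<Rightarrow> real ^ 'n ^ 'n"
  assumes S: "card S = Suc m" and B: "\<And>j. j \<in> S \<Longrightarrow> transpose (B j) = B j"
  shows "real (m * Suc m) * trace_exp (sum B S)
    \<le> (\<Sum>i\<in>S. \<Sum>j\<in>S - {i}. trace_exp (sum B (S - {i}) + B j))"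
\<comment> \<open>A singleton admits no exchange, so the index set for Jensen would be empty; the
  left side is zero.\<close>
proof (cases "m = 0")
  case True
  then show ?thesis
    by (auto intro!: sum_nonneg trace_exp_nonneg)
next
  case False
  have fin: "finite S"
    using S by (metis card.infinite nat.distinct(1))
  let ?P = "Sigma S (\<lambda>i. S - {i})"
  have cardP: "card ?P = m * Suc m"
    using fin S by (simp add: card_SigmaI mult.commute)
  \<comment> \<open>The inner sum over \<open>j\<close> gives \<open>m + 1\<close> copies of
    \<open>sum B S - B i\<close>; the sum over \<open>i\<close> then leaves
    \<open>m * (m + 1)\<close> copies of \<open>sum B S\<close>, one for each pair in
    \<open>?P\<close>.\<close>
  have "(\<Sum>p\<in>?P. sum B (S - {fst p}) + B (snd p)) = (\<Sum>i\<in>S. \<Sum>j\<in>S - {i}. sum B (S - {i}) + B j)"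
    using fin by (subst sum.Sigma) (auto simp: case_prod_beta)
  also have "\<dots> = (\<Sum>i\<in>S. real m *\<^sub>R sum B (S - {i}) + sum B (S - {i}))"
    using fin S by (intro sum.cong) (simp_all add: sum.distrib sum_constant_scaleR del: sum_constant)
  also have "\<dots> = (\<Sum>i\<in>S. real (Suc m) *\<^sub>R (sum B S - B i))"
    using fin by (intro sum.cong) (simp_all add: sum_diff1 algebra_simps)
  also have "\<dots> = real (Suc m) *\<^sub>R (real (Suc m) *\<^sub>R sum B S - sum B S)"
    using S by (simp add: scaleR_sum_right[symmetric] sum_subtractf sum_constant_scaleR del: sum_constant)
  also have "\<dots> = real (m * Suc m) *\<^sub>R sum B S"
    by (simp add: algebra_simps)
  finally have sumP: "real (card ?P) *\<^sub>R sum B S = (\<Sum>p\<in>?P. sum B (S - {fst p}) + B (snd p))"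
    by (simp add: cardP)
  have "?P \<noteq> {}"
    using cardP False by (metis card.empty mult_is_0 nat.distinct(1))
  moreover have "transpose (sum B (S - {fst p}) + B (snd p)) = sum B (S - {fst p}) + B (snd p)" if "p \<in> ?P" for p
    using that B by (auto simp: transpose_sum transpose_add)
  ultimately have "real (card ?P) * trace_exp (sum B S) \<le> (\<Sum>p\<in>?P. trace_exp (sum B (S - {fst p}) + B (snd p)))"
    using fin by (intro trace_exp_jensen[OF _ _ _ sumP]) auto
  also have "\<dots> = (\<Sum>i\<in>S. \<Sum>j\<in>S - {i}. trace_exp (sum B (S - {i}) + B j))"
    using fin by (subst sum.Sigma) (auto simp: case_prod_beta)
  finally show ?thesis
    by (simp add: cardP)
qed

text \<open>On the right an index \<open>j\<close> drawn from all of \<open>I\<close> is added to a random \<open>m\<close>-subset; the draws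
  with \<open>j \<in> S\<close> are compared with \<open>(m + 1)\<close>-subsets by the exchange inequality.\<close>

lemma trace_exp_without_replacement_step:
  fixes B :: "'i \<Rightarrow> real ^ 'n ^ 'n"
  assumes I: "finite I" "m < card I" and B: "\<And>j. j \<in> I \<Longrightarrow> transpose (B j) = B j"
  shows "real (Suc m * card I) * (\<Sum>S | S \<subseteq> I \<and> card S = Suc m. trace_exp (sum B S))
    \<le> real (card I - m) * (\<Sum>S | S \<subseteq> I \<and> card S = m. \<Sum>j\<in>I. trace_exp (sum B S + B j))"
proof -
  let ?U = "\<Sum>S | S \<subseteq> I \<and> card S = Suc m. trace_exp (sum B S)"
  let ?in = "\<Sum>S | S \<subseteq> I \<and> card S = m. \<Sum>j\<in>S. trace_exp (sum B S + B j)"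
  let ?out = "\<Sum>S | S \<subseteq> I \<and> card S = m. \<Sum>j\<in>I - S. trace_exp (sum B S + B j)"
  have fin: "finite S" if "S \<subseteq> I" for S
    using that I finite_subset by blast
  have "?out = (\<Sum>S | S \<subseteq> I \<and> card S = Suc m. \<Sum>j\<in>S. trace_exp (sum B (S - {j}) + B j))"
    by (rule sum_insert_eq_sum_remove[OF I(1)])
  also have "\<dots> = (\<Sum>S | S \<subseteq> I \<and> card S = Suc m. real (Suc m) * trace_exp (sum B S))"
    by (intro sum.cong) (simp_all add: fin sum_diff1)
  finally have out: "?out = real (Suc m) * ?U"
    by (simp add: sum_distrib_left)
  have "real (m * Suc m) * ?U \<le> (\<Sum>S | S \<subseteq> I \<and> card S = Suc m.
      \<Sum>i\<in>S. \<Sum>j\<in>S - {i}. trace_exp (sum B (S - {i}) + B j))"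
    unfolding sum_distrib_left using B by (intro sum_mono sum_trace_exp_exchange) auto
  \<comment> \<open>With \<open>S - {i}\<close> renamed to \<open>S\<close>, the summand no longer
    involves \<open>i\<close>, so the sum over \<open>i\<close> only contributes the factor
    \<open>card I - m\<close>.\<close>
  also have "\<dots> = (\<Sum>S | S \<subseteq> I \<and> card S = m. \<Sum>i\<in>I - S. \<Sum>j\<in>S. trace_exp (sum B S + B j))"
    by (rule sum_insert_eq_sum_remove[OF I(1), symmetric])
  also have "\<dots> = (\<Sum>S | S \<subseteq> I \<and> card S = m. real (card I - m) * (\<Sum>j\<in>S. trace_exp (sum B S + B j)))"
    by (intro sum.cong) (simp_all add: fin card_Diff_subset)
  finally have inn: "real (m * Suc m) * ?U \<le> real (card I - m) * ?in"
    by (simp add: sum_distrib_left)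
  have "(\<Sum>S | S \<subseteq> I \<and> card S = m. \<Sum>j\<in>I. trace_exp (sum B S + B j)) = ?out + ?in"
    unfolding sum.distrib[symmetric] using I(1) by (intro sum.cong sum.subset_diff) auto
  moreover have "real (Suc m * card I) * ?U = real (card I - m) * (real (Suc m) * ?U) + real (m * Suc m) * ?U"
    using I(2) by (simp add: of_nat_diff algebra_simps)
  ultimately show ?thesis
    using inn out by (simp add: distrib_left)
qed

text \<open>Induction on the sample size: the comparison with a draw from all of \<open>I\<close> is
  followed by the one-draw estimate. Sums over subsets replace expectations, hence the binomial
  coefficient; the dimension comes from the empty sample.\<close>

lemma trace_exp_without_replacement:
  fixes X :: "'i \<Rightarrow> real ^ 'n ^ 'n"
  assumes I: "finite I" "m \<le> card I" and X: "\<And>j. j \<in> I \<Longrightarrow> transpose (X j) = X j"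
    and X0: "\<And>j v. j \<in> I \<Longrightarrow> 0 \<le> v \<bullet> (X j *v v)"
    and XL: "\<And>j v. j \<in> I \<Longrightarrow> v \<bullet> (X j *v v) \<le> L * (v \<bullet> v)"
    and mean: "\<And>v. real (card I) * (\<gamma> * (v \<bullet> v)) \<le> (\<Sum>j\<in>I. v \<bullet> (X j *v v))"
    and L: "0 \<le> L" and \<theta>: "0 \<le> \<theta>" "\<theta> * L \<le> 1"
  shows "(\<Sum>S | S \<subseteq> I \<and> card S = m. trace_exp (\<Sum>j\<in>S. - \<theta> *\<^sub>R X j))
    \<le> real (card I choose m) * (exp (- (\<theta> * (1 - \<theta> * L / 2) * \<gamma>)) ^ m * real CARD('n))"
  using I(2)
proof (induction m)
  case 0
  have "{S. S \<subseteq> I \<and> card S = 0} = {{}}"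
    using I(1) finite_subset by fastforce
  then show ?case
    by (simp add: trace_exp_zero)
next
  case (Suc m)
  let ?r = "exp (- (\<theta> * (1 - \<theta> * L / 2) * \<gamma>))"
  let ?B = "\<lambda>j. - \<theta> *\<^sub>R X j"
  let ?U = "\<lambda>m. \<Sum>S | S \<subseteq> I \<and> card S = m. trace_exp (sum ?B S)"
  have B: "transpose (- \<theta> *\<^sub>R X j) = - \<theta> *\<^sub>R X j" if "j \<in> I" for j
    using X[OF that] by (simp add: transpose_scalar del: scaleR_minus_left)
  have symS: "transpose (sum ?B S) = sum ?B S" if "S \<subseteq> I" for S
    unfolding transpose_sum using B that by (intro sum.cong) auto
  have "real (Suc m * card I) * ?U (Suc m)
      \<le> real (card I - m) * (\<Sum>S | S \<subseteq> I \<and> card S = m. \<Sum>j\<in>I. trace_exp (sum ?B S + ?B j))"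
    using Suc.prems by (intro trace_exp_without_replacement_step B I) auto
  also have "\<dots> \<le> real (card I - m) * (\<Sum>S | S \<subseteq> I \<and> card S = m. real (card I) * (?r * trace_exp (sum ?B S)))"
  proof (intro mult_left_mono sum_mono)
    fix S assume "S \<in> {S. S \<subseteq> I \<and> card S = m}"
    then show "(\<Sum>j\<in>I. trace_exp (sum ?B S + ?B j)) \<le> real (card I) * (?r * trace_exp (sum ?B S))"
      using sum_trace_exp_step[OF symS X X0 XL mean L \<theta>, of S] by simp
  qed simp
  also have "\<dots> = real (card I) * (real (card I - m) * ?r * ?U m)"
    by (simp add: sum_distrib_left mult_ac)
  finally have "real (card I) * (real (Suc m) * ?U (Suc m)) \<le> real (card I) * (real (card I - m) * ?r * ?U m)"
    by (simp only: of_nat_mult mult_ac)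
  then have "real (Suc m) * ?U (Suc m) \<le> real (card I - m) * ?r * ?U m"
    by (rule mult_left_le_imp_le) (use Suc.prems in simp)
  also have "\<dots> \<le> real (card I - m) * ?r * (real (card I choose m) * (?r ^ m * real CARD('n)))"
    using Suc by (intro mult_left_mono) auto
  also have "\<dots> = real ((card I - m) * (card I choose m)) * (?r ^ Suc m * real CARD('n))"
    by simp
  also have "(card I - m) * (card I choose m) = Suc m * (card I choose Suc m)"
    by (simp only: binomial_absorption binomial_absorb_comp)
  finally have "real (Suc m) * ?U (Suc m)
      \<le> real (Suc m) * (real (card I choose Suc m) * (?r ^ Suc m * real CARD('n)))"
    by (simp only: of_nat_mult mult.assoc)
  then show ?case
    by (rule mult_left_le_imp_le) simp
qed

text \<open>The Laplace transform method: every bad sample contributes at least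
  \<open>exp (- \<theta> * t)\<close> to the sum of trace exponentials, so a bound on that sum
  limits the number of bad samples.\<close>

lemma matrix_chernoff_without_replacement:
  fixes X :: "nat \<Rightarrow> real ^ 'n ^ 'n"
  assumes s: "s \<le> n" and X: "\<And>j. j \<in> {1..n} \<Longrightarrow> transpose (X j) = X j"
    and X0: "\<And>j v. j \<in> {1..n} \<Longrightarrow> 0 \<le> v \<bullet> (X j *v v)"
    and XL: "\<And>j v. j \<in> {1..n} \<Longrightarrow> v \<bullet> (X j *v v) \<le> L * (v \<bullet> v)"
    and mean: "\<And>v. real n * (\<gamma> * (v \<bullet> v)) \<le> (\<Sum>j = 1..n. v \<bullet> (X j *v v))"
    and L: "0 < L" and \<epsilon>: "0 \<le> \<epsilon>" "\<epsilon> \<le> 1"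
  shows "measure_pmf.prob (sample_without_replacement n s)
      {S. \<exists>v. v \<bullet> ((\<Sum>j\<in>S. X j) *v v) < real s * ((1 - \<epsilon>) * \<gamma>) * (v \<bullet> v)}
    \<le> real CARD('n) * exp (- (\<epsilon>\<^sup>2 * real s * \<gamma> / (2 * L)))"
proof -
  \<comment> \<open>The exponent will be \<open>- s \<gamma>\<close> times
    \<open>\<theta> (\<epsilon> - \<theta> L / 2)\<close>, and this choice maximizes the latter
    factor. The side condition \<open>\<theta> L \<le> 1\<close> becomes
    \<open>\<epsilon> \<le> 1\<close>.\<close>
  define \<theta> where "\<theta> = \<epsilon> / L"
  define \<Omega> where "\<Omega> = {S. S \<subseteq> {1..n} \<and> card S = s}"
  define t where "t = real s * ((1 - \<epsilon>) * \<gamma>)"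
  define bad where "bad = {S. \<exists>v. v \<bullet> ((\<Sum>j\<in>S. X j) *v v) < t * (v \<bullet> v)}"
  have \<theta>: "0 \<le> \<theta>" "\<theta> * L = \<epsilon>"
    using \<epsilon> L by (simp_all add: \<theta>_def)
  have card\<Omega>: "card \<Omega> = n choose s"
    by (simp add: \<Omega>_def n_subsets)
  have fin: "finite \<Omega>"
    by (simp add: \<Omega>_def)
  have pos: "0 < real (card \<Omega>)"
    using s by (simp add: card\<Omega>)
  then have ne: "\<Omega> \<noteq> {}"
    by auto
  have lower: "exp (- \<theta> * t) \<le> trace_exp (\<Sum>j\<in>S. - \<theta> *\<^sub>R X j)" if S: "S \<in> \<Omega> \<inter> bad" for S
  proof -
    obtain v where v: "v \<bullet> ((\<Sum>j\<in>S. X j) *v v) < t * (v \<bullet> v)"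
      using S by (auto simp: bad_def)
    then have "v \<noteq> 0"
      by auto
    define w where "w = v /\<^sub>R norm v"
    have w1: "w \<bullet> w = 1"
      using \<open>v \<noteq> 0\<close> by (simp add: w_def dot_square_norm power2_eq_square)
    have "v = norm v *\<^sub>R w"
      using \<open>v \<noteq> 0\<close> by (simp add: w_def)
    then have "(norm v)\<^sup>2 * (w \<bullet> ((\<Sum>j\<in>S. X j) *v w)) < (norm v)\<^sup>2 * t"
      using v w1 by (metis (no_types, lifting) inner_scaleR_left inner_scaleR_right matrix_vector_mult_scaleR
          mult.assoc mult.commute mult.right_neutral power2_eq_square)
    then have wt: "w \<bullet> ((\<Sum>j\<in>S. X j) *v w) \<le> t"
      using \<open>v \<noteq> 0\<close> by simp
    have sumS: "(\<Sum>j\<in>S. - \<theta> *\<^sub>R X j) = - \<theta> *\<^sub>R (\<Sum>j\<in>S. X j)"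
      by (simp add: scaleR_sum_right sum_negf)
    have "transpose (\<Sum>j\<in>S. X j) = (\<Sum>j\<in>S. X j)"
      unfolding transpose_sum using S X by (intro sum.cong) (auto simp: \<Omega>_def)
    then have "exp (w \<bullet> ((- \<theta> *\<^sub>R (\<Sum>j\<in>S. X j)) *v w)) \<le> trace_exp (- \<theta> *\<^sub>R (\<Sum>j\<in>S. X j))"
      by (intro exp_quadratic_form_le_trace_exp w1) (simp add: transpose_scalar del: scaleR_minus_left)
    moreover have "- \<theta> * t \<le> w \<bullet> ((- \<theta> *\<^sub>R (\<Sum>j\<in>S. X j)) *v w)"
      using mult_left_mono[OF wt \<theta>(1)]
      by (simp add: scaleR_matrix_vector_assoc[symmetric] del: scaleR_minus_left)
    ultimately show ?thesis
      unfolding sumS by (meson exp_le_cancel_iff order_trans)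
  qed
  have "real (card (\<Omega> \<inter> bad)) * exp (- \<theta> * t) = (\<Sum>S\<in>\<Omega> \<inter> bad. exp (- \<theta> * t))"
    by simp
  also have "\<dots> \<le> (\<Sum>S\<in>\<Omega> \<inter> bad. trace_exp (\<Sum>j\<in>S. - \<theta> *\<^sub>R X j))"
    by (intro sum_mono lower)
  also have "\<dots> \<le> (\<Sum>S\<in>\<Omega>. trace_exp (\<Sum>j\<in>S. - \<theta> *\<^sub>R X j))"
    using fin by (intro sum_mono2 trace_exp_nonneg) auto
  also have "\<dots> \<le> real (card {1..n} choose s) * (exp (- (\<theta> * (1 - \<theta> * L / 2) * \<gamma>)) ^ s * real CARD('n))"
    unfolding \<Omega>_def using s mean L \<theta> \<epsilon> by (intro trace_exp_without_replacement X X0 XL) auto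
  finally have *: "real (card (\<Omega> \<inter> bad)) * exp (- \<theta> * t)
      \<le> real (card \<Omega>) * (exp (- (\<theta> * (1 - \<epsilon> / 2) * \<gamma>)) ^ s * real CARD('n))"
    using \<theta>(2) by (simp add: card\<Omega>)
  have "real (card (\<Omega> \<inter> bad)) = real (card (\<Omega> \<inter> bad)) * exp (- \<theta> * t) * exp (\<theta> * t)"
    by (simp add: exp_minus)
  also have "\<dots> \<le> real (card \<Omega>) * (exp (- (\<theta> * (1 - \<epsilon> / 2) * \<gamma>)) ^ s * real CARD('n)) * exp (\<theta> * t)"
    using * by (intro mult_right_mono) auto
  also have "\<dots> = real (card \<Omega>) * (real CARD('n) * exp (\<theta> * t - real s * (\<theta> * (1 - \<epsilon> / 2) * \<gamma>)))"
  proof -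
    have "exp (- c) ^ s * exp b = exp (b - real s * c)" for b c :: real
      by (simp add: exp_of_nat_mult[symmetric] exp_add[symmetric])
    from this[of "\<theta> * (1 - \<epsilon> / 2) * \<gamma>" "\<theta> * t"] show ?thesis
      by (metis (no_types, lifting) mult.assoc mult.commute)
  qed
  also have "\<theta> * t - real s * (\<theta> * (1 - \<epsilon> / 2) * \<gamma>) = - (\<epsilon>\<^sup>2 * real s * \<gamma> / (2 * L))"
    using L by (simp add: \<theta>_def t_def field_simps power2_eq_square)
  finally have "real (card (\<Omega> \<inter> bad)) / real (card \<Omega>) \<le> real CARD('n) * exp (- (\<epsilon>\<^sup>2 * real s * \<gamma> / (2 * L)))"
    using pos by (simp add: pos_divide_le_eq mult.commute)
  moreover have "measure_pmf.prob (sample_without_replacement n s) bad = real (card (\<Omega> \<inter> bad)) / real (card \<Omega>)"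
    unfolding sample_without_replacement_def \<Omega>_def[symmetric] by (rule measure_pmf_of_set[OF ne fin])
  ultimately show ?thesis
    by (simp only: bad_def t_def)
qed

section \<open>Averages of the largest values, gradients and Hessians\<close>

lemma sum_list_le_take_sorted:
  fixes xs ys :: "'a::linordered_idom list"
  assumes "sorted_wrt (\<ge>) xs" "mset ys \<subseteq># mset xs"
  shows "sum_list ys \<le> sum_list (take (length ys) xs)"
  using assms
proof (induction xs arbitrary: ys)
  case (Cons x xs)
  show ?case
  proof (cases "ys = []")
    case False
    \<comment> \<open>If \<open>x\<close> occurs in \<open>ys\<close>, it must be the element
      removed, so that the rest embeds in \<open>xs\<close>. Otherwise all of \<open>ys\<close>
      already embeds in \<open>xs\<close>, and any element may be removed.\<close>
    define y where "y = (if x \<in> set ys then x else hd ys)"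
    have y: "y \<in> set ys"
      using False by (simp add: y_def)
    then have "y \<in> set (x # xs)"
      using Cons.prems(2) by (metis in_mono set_mset_mono set_mset_mset)
    then have "y \<le> x"
      using Cons.prems(1) by auto
    have "mset (remove1 y ys) \<subseteq># mset xs"
    proof (cases "x \<in> set ys")
      case True
      then show ?thesis
        using Cons.prems(2) by (simp add: y_def subset_eq_diff_conv)
    next
      case False
      have "count (mset ys) a \<le> count (mset xs) a" for a
        using mset_subset_eq_count[OF Cons.prems(2), of a] False
        by (cases "a = x") (auto simp: count_mset)
      then have "mset ys \<subseteq># mset xs"
        by (rule mset_subset_eqI)
      then show ?thesis
        by (simp add: subset_mset.order_trans[OF diff_subset_eq_self])
    qed
    then have "sum_list (remove1 y ys) \<le> sum_list (take (length ys - 1) xs)"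
      using Cons.IH[of "remove1 y ys"] Cons.prems(1) y by (simp add: length_remove1)
    moreover have "sum_list ys = y + sum_list (remove1 y ys)"
      using sum_list_map_remove1[OF y, of "\<lambda>x. x"] by simp
    moreover obtain k where "length ys = Suc k"
      using False by (cases ys) auto
    ultimately show ?thesis
      using \<open>y \<le> x\<close> by simp
  qed simp
qed simp

text \<open>The values on \<open>S\<close> form a sub-multiset of all values, so the
  \<open>card S\<close> largest ones dominate them. This bounds the top eigenvalue of every sampled
  Hessian, with no exceptional event.\<close>

lemma average_le_Khat:
  assumes "S \<subseteq> {1..n}"
  shows "(\<Sum>j\<in>S. K j) / real (card S) \<le> Khat n K (card S)"
proof -
  have fin: "finite S"
    using assms finite_subset by blast
  define ys where "ys = map K (sorted_list_of_set S)"
  have "mset (sorted_list_of_set S) \<subseteq># mset [1..<Suc n]"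
    using assms fin
    by (simp add: mset_set_set[symmetric] atLeastLessThanSuc_atLeastAtMost del: upt_Suc mset_upt)
  then have "mset ys \<subseteq># mset (rev (sort (map K [1..<Suc n])))"
    by (simp add: ys_def image_mset_subseteq_mono del: upt_Suc)
  moreover have "sorted_wrt (\<ge>) (rev (sort (map K [1..<Suc n])))"
    by (simp add: sorted_wrt_rev del: upt_Suc)
  ultimately have "sum_list ys \<le> sum_list (take (length ys) (rev (sort (map K [1..<Suc n]))))"
    by (rule sum_list_le_take_sorted[rotated])
  moreover have "sum_list ys = (\<Sum>j\<in>S. K j)"
    by (metis ys_def fin set_sorted_list_of_set distinct_sorted_list_of_set sum_list_distinct_conv_sum_set)
  moreover have "length ys = card S"
    by (simp add: ys_def)
  ultimately show ?thesis
    by (simp add: Khat_def divide_right_mono del: upt_Suc)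
qed

lemma le_Khat_1:
  assumes "i \<in> {1..n}"
  shows "K i \<le> Khat n K 1"
  using average_le_Khat[of "{i}" n K] assms by simp

section \<open>Gradients, Hessians and second-order bounds\<close>

lemma gradient_works:
  assumes "f differentiable (at x)"
  shows "(f has_derivative (\<lambda>h. gradient f x \<bullet> h)) (at x)"
proof -
  let ?D = "frechet_derivative f (at x)"
  have D: "(f has_derivative ?D) (at x)"
    using assms frechet_derivative_works by blast
  then interpret linear ?D
    by (rule has_derivative_linear)
  have "?D h = gradient f x \<bullet> h" for h
  proof -
    have "?D h = ?D (\<Sum>i\<in>UNIV. h $ i *\<^sub>R axis i 1)"
      using basis_expansion[of h] by (simp add: scalar_mult_eq_scaleR)
    also have "\<dots> = (\<Sum>i\<in>UNIV. h $ i * ?D (axis i 1))"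
      by (simp add: sum scale)
    also have "\<dots> = gradient f x \<bullet> h"
      by (simp add: gradient_def inner_vec_def mult.commute)
    finally show ?thesis .
  qed
  then have "?D = (\<lambda>h. gradient f x \<bullet> h)"
    by auto
  with D show ?thesis
    by simp
qed

lemma gradient_unique:
  assumes "(f has_derivative (\<lambda>h. g \<bullet> h)) (at x)"
  shows "gradient f x = g"
proof -
  have "frechet_derivative f (at x) = (\<lambda>h. g \<bullet> h)"
    using frechet_derivative_at[OF assms] by simp
  then show ?thesis
    by (simp add: gradient_def inner_axis vec_eq_iff)
qed

lemma hessian_works:
  assumes "gradient f differentiable (at x)"
  shows "(gradient f has_derivative (\<lambda>h. hessian f x *v h)) (at x)"
  using assms jacobian_works[of "gradient f" "at x"] by (simp add: hessian_def)

lemma hessian_unique: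
  assumes "(gradient f has_derivative (\<lambda>h. A *v h)) (at x)"
  shows "hessian f x = A"
  using frechet_derivative_at[OF assms] by (metis hessian_def jacobian_def matrix_of_matrix_vector_mul)

lemma average_fun_derivatives:
  assumes f: "\<And>i. i \<in> {1..n} \<Longrightarrow> twice_differentiable (f i)"
  shows "twice_differentiable (average_fun n f)"
    and "hessian (average_fun n f) x = (1 / real n) *\<^sub>R (\<Sum>i = 1..n. hessian (f i) x)"
proof -
  have avg: "average_fun n f = (\<lambda>x. (1 / real n) * (\<Sum>i = 1..n. f i x))"
    by (simp add: average_fun_def fun_eq_iff)
  have D: "(average_fun n f has_derivative (\<lambda>h. ((1 / real n) *\<^sub>R (\<Sum>i = 1..n. gradient (f i) x)) \<bullet> h)) (at x)" for x
  proof -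
    have "(average_fun n f has_derivative (\<lambda>h. (1 / real n) * (\<Sum>i = 1..n. gradient (f i) x \<bullet> h))) (at x)"
      unfolding avg using f
      by (intro has_derivative_mult_right has_derivative_sum gradient_works) (auto simp: twice_differentiable_def)
    then show ?thesis
      by (simp add: inner_sum_left)
  qed
  have grad: "gradient (average_fun n f) = (\<lambda>x. (1 / real n) *\<^sub>R (\<Sum>i = 1..n. gradient (f i) x))"
    using gradient_unique[OF D] by auto
  have H: "(gradient (average_fun n f) has_derivative
      (\<lambda>h. ((1 / real n) *\<^sub>R (\<Sum>i = 1..n. hessian (f i) x)) *v h)) (at x)" for x
  proof -
    have "(gradient (average_fun n f) has_derivative
        (\<lambda>h. (1 / real n) *\<^sub>R (\<Sum>i = 1..n. hessian (f i) x *v h))) (at x)"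
      unfolding grad using f
      by (intro has_derivative_scaleR_right has_derivative_sum hessian_works) (auto simp: twice_differentiable_def)
    then show ?thesis
      by (simp add: matrix_vector_mult_sum scaleR_matrix_vector_assoc[symmetric])
  qed
  show "twice_differentiable (average_fun n f)"
    unfolding twice_differentiable_def using D H by (blast intro: differentiableI)
  show "hessian (average_fun n f) x = (1 / real n) *\<^sub>R (\<Sum>i = 1..n. hessian (f i) x)"
    by (rule hessian_unique[OF H])
qed

text \<open>One-dimensional Taylor expansion along the segment from \<open>x\<close> to
  \<open>x + h\<close>. The Lagrange form of the remainder suits
  \<open>twice_differentiable\<close>, which does not assert continuity of the Hessian.\<close>

lemma second_order_taylor:
  assumes "twice_differentiable F"
  obtains z where "F (x + h) = F x + gradient F x \<bullet> h + (h \<bullet> (hessian F z *v h)) / 2"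
proof -
  define \<phi> where "\<phi> = (\<lambda>t. F (x + t *\<^sub>R h))"
  define \<phi>' where "\<phi>' = (\<lambda>t. gradient F (x + t *\<^sub>R h) \<bullet> h)"
  define \<phi>'' where "\<phi>'' = (\<lambda>t. h \<bullet> (hessian F (x + t *\<^sub>R h) *v h))"
  have line: "((\<lambda>t. x + t *\<^sub>R h) has_derivative (\<lambda>s. s *\<^sub>R h)) (at t)" for t
    by (auto intro!: derivative_eq_intros)
  have "(F has_derivative (\<lambda>k. gradient F z \<bullet> k)) (at z)" for z
    using assms by (intro gradient_works) (simp add: twice_differentiable_def)
  from has_derivative_compose[OF line this] have d1: "(\<phi> has_real_derivative \<phi>' t) (at t)" for t
    by (simp add: has_field_derivative_def \<phi>_def \<phi>'_def mult_commute_abs)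
  have "(gradient F has_derivative (\<lambda>k. hessian F z *v k)) (at z)" for z
    using assms by (intro hessian_works) (simp add: twice_differentiable_def)
  from has_derivative_inner_left[OF has_derivative_compose[OF line this], of h]
  have d2: "(\<phi>' has_real_derivative \<phi>'' t) (at t)" for t
    by (simp add: has_field_derivative_def \<phi>'_def \<phi>''_def mult_commute_abs inner_commute matrix_vector_mult_scaleR)
  define diff where "diff m = (if m = 0 then \<phi> else if m = 1 then \<phi>' else \<phi>'')" for m :: nat
  have "\<exists>t. 0 < t \<and> t < 1 \<and> \<phi> 1 = (\<Sum>m<2. (diff m 0 / fact m) * (1 - 0) ^ m) + (diff 2 t / fact 2) * (1 - 0)\<^sup>2"
    using d1 d2 by (intro Taylor_up[where a = 0]) (auto simp: diff_def less_2_cases_iff)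
  then obtain t where "\<phi> 1 = \<phi> 0 + \<phi>' 0 + \<phi>'' t / 2"
    by (auto simp: diff_def numeral_2_eq_2)
  then show thesis
    using that by (simp add: \<phi>_def \<phi>'_def \<phi>''_def)
qed

lemma mat_vector_mult: "mat c *v (v :: real ^ 'n) = c *\<^sub>R v"
  by (simp add: mat_def matrix_vector_mult_def vec_eq_iff if_distrib[of "\<lambda>x. x * _"] cong: if_cong)

lemma loewner_le_quadratic_form:
  assumes "A \<preceq>\<^sub>L B"
  shows "v \<bullet> (A *v v) \<le> v \<bullet> (B *v v)"
  using assms by (auto simp: loewner_le_def matrix_vector_mult_diff_rdistrib inner_diff_right dest: spec[of _ v])

text \<open>The Polyak-Lojasiewicz inequality, with an arbitrary \<open>y\<close> in place of the
  minimizer: the quadratic lower bound from Taylor's formula is minimized over \<open>h\<close> by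
  completing the square.\<close>

lemma strongly_convex_gradient_bound:
  assumes F: "twice_differentiable F" and "0 < \<gamma>" and \<gamma>: "\<And>z. mat \<gamma> \<preceq>\<^sub>L hessian F z"
  shows "F x - F y \<le> (gradient F x \<bullet> gradient F x) / (2 * \<gamma>)"
proof -
  let ?g = "gradient F x"
  define h where "h = y - x"
  obtain z where z: "F (x + h) = F x + ?g \<bullet> h + (h \<bullet> (hessian F z *v h)) / 2"
    using second_order_taylor[OF F] .
  have "\<gamma> * (h \<bullet> h) \<le> h \<bullet> (hessian F z *v h)"
    using loewner_le_quadratic_form[OF \<gamma>, of h z] by (simp add: mat_vector_mult)
  then have "F x - F y \<le> - (?g \<bullet> h) - \<gamma> * (h \<bullet> h) / 2"
    using z by (simp add: h_def)
  moreover have "0 \<le> (?g + \<gamma> *\<^sub>R h) \<bullet> (?g + \<gamma> *\<^sub>R h) / (2 * \<gamma>)"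
    using \<open>0 < \<gamma>\<close> by simp
  moreover have "(?g + \<gamma> *\<^sub>R h) \<bullet> (?g + \<gamma> *\<^sub>R h) / (2 * \<gamma>)
      = (?g \<bullet> ?g) / (2 * \<gamma>) + ?g \<bullet> h + \<gamma> * (h \<bullet> h) / 2"
    using \<open>0 < \<gamma>\<close> by (simp add: inner_add_left inner_add_right inner_commute field_simps)
  ultimately show ?thesis
    by linarith
qed

lemma smooth_upper_bound:
  assumes F: "twice_differentiable F" and L: "\<And>z. hessian F z \<preceq>\<^sub>L mat L"
  shows "F (x + h) \<le> F x + gradient F x \<bullet> h + L * (h \<bullet> h) / 2"
proof -
  obtain z where z: "F (x + h) = F x + gradient F x \<bullet> h + (h \<bullet> (hessian F z *v h)) / 2"
    using second_order_taylor[OF F] .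
  have "h \<bullet> (hessian F z *v h) \<le> L * (h \<bullet> h)"
    using loewner_le_quadratic_form[OF L, of h z] by (simp add: mat_vector_mult)
  then show ?thesis
    using z by simp
qed

section \<open>One iteration of the sub-sampled Newton method\<close>

text \<open>In an eigenbasis of \<open>H\<close> the direction is the residual minus the gradient,
  divided by the eigenvalue. The residual is charged to the smallest eigenvalue bound
  \<open>m\<close> and the gradient to the largest \<open>M\<close>, which is why the tolerance
  involves \<open>sqrt (m / M)\<close>.\<close>

lemma inexact_direction_descent:
  fixes H :: "real ^ 'n ^ 'n"
  assumes H: "transpose H = H" and "0 < m"
    and mH: "\<And>v. m * (v \<bullet> v) \<le> v \<bullet> (H *v v)" and HM: "\<And>v. v \<bullet> (H *v v) \<le> M * (v \<bullet> v)"
    and p: "inexact_direction H g \<theta>\<^sub>1 \<theta>\<^sub>2 p" and \<theta>: "0 \<le> \<theta>\<^sub>1" "\<theta>\<^sub>1 \<le> 1 / 2 * sqrt (m / M)"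
  shows "p \<bullet> g \<le> - (g \<bullet> g) / (2 * M)"
proof -
  let ?W = "eigenvectors H"
  have W: "orthonormal_basis ?W" "eigenbasis H ?W"
    by (simp_all add: H eigenbasis_eigenvectors orthonormal_basis_eigenvectors)
  define r where "r = H *v p + g"
  have "m \<le> M"
    using mH[of "axis undefined 1"] HM[of "axis undefined 1"] by (simp add: inner_axis_axis)
  then have M: "0 < M"
    using \<open>0 < m\<close> by simp
  have "(norm r)\<^sup>2 \<le> (\<theta>\<^sub>1 * norm g)\<^sup>2"
    using p by (intro power_mono) (simp_all add: inexact_direction_def r_def)
  also have "\<dots> \<le> (1 / 2 * sqrt (m / M))\<^sup>2 * (norm g)\<^sup>2"
    unfolding power_mult_distrib[of \<theta>\<^sub>1] using \<theta> by (intro mult_right_mono power_mono) auto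
  also have "\<dots> = m / (4 * M) * (g \<bullet> g)"
    using \<open>0 < m\<close> M by (simp add: power_mult_distrib power_divide dot_square_norm)
  finally have r: "(r \<bullet> r) / m \<le> (g \<bullet> g) / (4 * M)"
    using \<open>0 < m\<close> by (simp add: dot_square_norm field_simps)
  have coord: "(w \<bullet> p) * (w \<bullet> g) \<le> (w \<bullet> r)\<^sup>2 / m - 3 / 4 * ((w \<bullet> g)\<^sup>2 / M)" if w: "w \<in> ?W" for w
  proof -
    define l where "l = w \<bullet> (H *v w)"
    have l: "m \<le> l" "l \<le> M"
      using mH[of w] HM[of w] orthonormal_basis_norm[OF W(1) w] by (simp_all add: l_def)
    have "w \<bullet> r = l * (w \<bullet> p) + w \<bullet> g"
      by (simp add: r_def inner_add_right eigenbasis_inner[OF H W(2) w, of p] l_def)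
    then have "(w \<bullet> p) * (w \<bullet> g) = (w \<bullet> r - w \<bullet> g) * (w \<bullet> g) / l"
      using l \<open>0 < m\<close> by simp
    also have "\<dots> \<le> ((w \<bullet> r)\<^sup>2 - 3 / 4 * (w \<bullet> g)\<^sup>2) / l"
    proof (rule divide_right_mono)
      \<comment> \<open>This way of splitting the mixed term leaves \<open>3 / 4\<close> of the
        gradient part; the residual later costs \<open>1 / 4\<close>, so \<open>1 / 2\<close>
        remains.\<close>
      have "0 \<le> (w \<bullet> r - (w \<bullet> g) / 2)\<^sup>2"
        by simp
      then show "(w \<bullet> r - w \<bullet> g) * (w \<bullet> g) \<le> (w \<bullet> r)\<^sup>2 - 3 / 4 * (w \<bullet> g)\<^sup>2"
        by (simp add: power2_eq_square algebra_simps)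
    qed (use l \<open>0 < m\<close> in simp)
    also have "\<dots> = (w \<bullet> r)\<^sup>2 / l - 3 / 4 * ((w \<bullet> g)\<^sup>2 / l)"
      by (simp add: diff_divide_distrib)
    also have "\<dots> \<le> (w \<bullet> r)\<^sup>2 / m - 3 / 4 * ((w \<bullet> g)\<^sup>2 / M)"
      using l \<open>0 < m\<close> by (intro diff_mono mult_left_mono divide_left_mono) auto
    finally show ?thesis .
  qed
  have "p \<bullet> g = (\<Sum>w\<in>?W. (w \<bullet> p) * (w \<bullet> g))"
    by (simp add: orthonormal_basis_parseval[OF W(1)])
  also have "\<dots> \<le> (\<Sum>w\<in>?W. (w \<bullet> r)\<^sup>2 / m - 3 / 4 * ((w \<bullet> g)\<^sup>2 / M))"
    by (intro sum_mono coord)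
  also have "\<dots> = (r \<bullet> r) / m - 3 / 4 * ((g \<bullet> g) / M)"
    by (simp add: sum_subtractf orthonormal_basis_parseval_norm[OF W(1), symmetric]
        sum_divide_distrib[symmetric] sum_distrib_left[symmetric])
  also have "\<dots> \<le> - (g \<bullet> g) / (2 * M)"
    using r by simp
  finally show ?thesis .
qed

text \<open>The Armijo decrease is at least \<open>\<alpha> * \<beta>\<close> times the squared
  gradient norm over \<open>2 * M\<close>, and strong convexity bounds that norm below by the gap
  \<open>F x - F y\<close>.\<close>

lemma line_search_contraction:
  assumes F: "twice_differentiable F" and "0 < \<gamma>" and \<gamma>: "\<And>z. mat \<gamma> \<preceq>\<^sub>L hessian F z"
    and ls: "line_search_step F \<beta> \<alpha>max x p \<alpha>" and "0 \<le> \<alpha>max" "0 \<le> \<beta>" "0 < M"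
    and desc: "p \<bullet> gradient F x \<le> - (gradient F x \<bullet> gradient F x) / (2 * M)"
  shows "F (x + \<alpha> *\<^sub>R p) - F y \<le> (1 - \<alpha> * \<beta> * \<gamma> / M) * (F x - F y)"
proof -
  let ?g = "gradient F x"
  \<comment> \<open>The zero step satisfies the Armijo condition, and \<open>\<alpha>\<close> is the
    largest admissible step.\<close>
  have "0 \<le> \<alpha>"
    using ls \<open>0 \<le> \<alpha>max\<close> by (auto simp: line_search_step_def armijo_def)
  then have \<alpha>\<beta>: "0 \<le> \<alpha> * \<beta>"
    using \<open>0 \<le> \<beta>\<close> by simp
  have "F (x + \<alpha> *\<^sub>R p) - F x \<le> \<alpha> * \<beta> * (p \<bullet> ?g)"
    using ls by (simp add: line_search_step_def armijo_def)
  also have "\<dots> \<le> \<alpha> * \<beta> * (- (?g \<bullet> ?g) / (2 * M))"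
    using desc \<alpha>\<beta> by (rule mult_left_mono)
  also have "\<dots> \<le> \<alpha> * \<beta> * (- (\<gamma> * (F x - F y)) / M)"
  proof (rule mult_left_mono[OF _ \<alpha>\<beta>])
    have "\<gamma> * (F x - F y) \<le> (?g \<bullet> ?g) / 2"
      using strongly_convex_gradient_bound[OF F \<open>0 < \<gamma>\<close> \<gamma>, of x y] \<open>0 < \<gamma>\<close> by (simp add: field_simps)
    then show "- (?g \<bullet> ?g) / (2 * M) \<le> - (\<gamma> * (F x - F y)) / M"
      using \<open>0 < M\<close> by (simp add: field_simps)
  qed
  finally show ?thesis
    by (simp add: algebra_simps diff_divide_distrib)
qed

text \<open>The stated minimum itself satisfies the Armijo condition, so the largest admissible step
  is no smaller. The cap \<open>\<alpha>max\<close> keeps this candidate admissible.\<close>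

lemma line_search_step_size:
  assumes F: "twice_differentiable F" and "0 < L" and L: "\<And>z. hessian F z \<preceq>\<^sub>L mat L"
    and mH: "\<And>v. m * (v \<bullet> v) \<le> v \<bullet> (H *v v)" and "0 \<le> m"
    and p: "inexact_direction H (gradient F x) \<theta>\<^sub>1 \<theta>\<^sub>2 p" and ls: "line_search_step F \<beta> \<alpha>max x p \<alpha>"
    and "0 \<le> \<alpha>max" "\<theta>\<^sub>2 \<le> 1" "\<beta> \<le> 1"
  shows "min \<alpha>max (2 * (1 - \<theta>\<^sub>2) * (1 - \<beta>) * m / L) \<le> \<alpha>"
proof -
  let ?g = "gradient F x"
  define a where "a = min \<alpha>max (2 * (1 - \<theta>\<^sub>2) * (1 - \<beta>) * m / L)"
  have a: "0 \<le> a" "a \<le> \<alpha>max"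
    using assms by (auto simp: a_def)
  have "a \<le> 2 * (1 - \<theta>\<^sub>2) * (1 - \<beta>) * m / L"
    by (simp add: a_def)
  then have aL: "a * L / 2 \<le> (1 - \<beta>) * ((1 - \<theta>\<^sub>2) * m)"
    using \<open>0 < L\<close> by (simp add: field_simps)
  have "(1 - \<theta>\<^sub>2) * m * (p \<bullet> p) \<le> (1 - \<theta>\<^sub>2) * (p \<bullet> (H *v p))"
    unfolding mult.assoc using mH[of p] \<open>\<theta>\<^sub>2 \<le> 1\<close> by (intro mult_left_mono) auto
  also have "\<dots> \<le> - (p \<bullet> ?g)"
    using p by (simp add: inexact_direction_def algebra_simps)
  finally have pg: "(1 - \<theta>\<^sub>2) * m * (p \<bullet> p) \<le> - (p \<bullet> ?g)" .
  have "a * L / 2 * (p \<bullet> p) \<le> (1 - \<beta>) * ((1 - \<theta>\<^sub>2) * m) * (p \<bullet> p)"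
    using aL by (rule mult_right_mono) simp
  also have "\<dots> \<le> (1 - \<beta>) * - (p \<bullet> ?g)"
    unfolding mult.assoc[of "1 - \<beta>"] using pg \<open>\<beta> \<le> 1\<close> by (intro mult_left_mono) auto
  finally have "a * (a * L / 2 * (p \<bullet> p)) \<le> a * ((1 - \<beta>) * - (p \<bullet> ?g))"
    using a(1) by (rule mult_left_mono)
  then have "a * (p \<bullet> ?g) + L * (a * a * (p \<bullet> p)) / 2 \<le> a * \<beta> * (p \<bullet> ?g)"
    by (simp add: algebra_simps)
  then have "armijo F \<beta> x p a"
    using smooth_upper_bound[OF F L, of x "a *\<^sub>R p"]
    by (simp add: armijo_def inner_commute[of ?g] mult.assoc)
  then show ?thesis
    using ls a(2) by (simp add: line_search_step_def a_def)
qed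

text \<open>The second claim uses the unnormalized sum, which is the form of the event in the
  Chernoff bound; the third holds for every sample.\<close>

lemma ridge_hessian_bounds:
  fixes f :: "nat \<Rightarrow> real ^ 'n \<Rightarrow> real"
  assumes S: "S \<subseteq> {1..n}" "card S = s" "0 < s"
    and h: "\<And>i. i \<in> {1..n} \<Longrightarrow> 0 \<preceq>\<^sub>L hessian (f i) x \<and> hessian (f i) x \<preceq>\<^sub>L mat (K i)"
  shows "transpose (ridge_hessian f lam S x) = ridge_hessian f lam S x"
    and "v \<bullet> (ridge_hessian f lam S x *v v) = (v \<bullet> ((\<Sum>j\<in>S. hessian (f j) x) *v v)) / real s + lam * (v \<bullet> v)"
    and "v \<bullet> (ridge_hessian f lam S x *v v) \<le> (Khat n K s + lam) * (v \<bullet> v)"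
proof -
  have "transpose (hessian (f j) x) = hessian (f j) x" if "j \<in> S" for j
    using h[of j] that S by (auto simp: loewner_le_def)
  then have "transpose (\<Sum>j\<in>S. hessian (f j) x) = (\<Sum>j\<in>S. hessian (f j) x)"
    unfolding transpose_sum by (intro sum.cong) auto
  then show "transpose (ridge_hessian f lam S x) = ridge_hessian f lam S x"
    by (simp add: ridge_hessian_def subsampled_hessian_def transpose_add transpose_scalar)
  show quad: "v \<bullet> (ridge_hessian f lam S x *v v)
      = (v \<bullet> ((\<Sum>j\<in>S. hessian (f j) x) *v v)) / real s + lam * (v \<bullet> v)"
    using S by (simp add: ridge_hessian_def subsampled_hessian_def matrix_vector_mult_add_rdistrib
        inner_add_right scaleR_matrix_vector_assoc[symmetric] mat_vector_mult)
  have "v \<bullet> ((\<Sum>j\<in>S. hessian (f j) x) *v v) = (\<Sum>j\<in>S. v \<bullet> (hessian (f j) x *v v))"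
    by (simp add: matrix_vector_mult_sum inner_sum_right)
  also have "\<dots> \<le> (\<Sum>j\<in>S. K j * (v \<bullet> v))"
  proof (rule sum_mono)
    fix j assume "j \<in> S"
    then show "v \<bullet> (hessian (f j) x *v v) \<le> K j * (v \<bullet> v)"
      using h[of j] S loewner_le_quadratic_form[of "hessian (f j) x" "mat (K j)" v]
      by (auto simp: mat_vector_mult)
  qed
  finally have "(v \<bullet> ((\<Sum>j\<in>S. hessian (f j) x) *v v)) / real s \<le> (\<Sum>j\<in>S. K j) / real s * (v \<bullet> v)"
    by (simp add: sum_distrib_right[symmetric] divide_right_mono)
  also have "\<dots> \<le> Khat n K s * (v \<bullet> v)"
    using average_le_Khat[OF S(1), of K] S(2) by (intro mult_right_mono) auto
  finally show "v \<bullet> (ridge_hessian f lam S x *v v) \<le> (Khat n K s + lam) * (v \<bullet> v)"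
    unfolding quad by (simp add: distrib_right)
qed

text \<open>The point \<open>x\<close> is fixed before the sample is drawn, and one event covers all
  admissible directions and steps. The contraction belongs to this event because its proof uses the
  lower eigenvalue bound. The step bound is capped at \<open>\<alpha>max\<close>, which no step
  exceeds but which the uncapped expression can exceed for large \<open>lam\<close>.\<close>

theorem corollary2:
  fixes f :: "nat \<Rightarrow> real ^ 'p \<Rightarrow> real"
    and F :: "real ^ 'p \<Rightarrow> real"
    and K :: "nat \<Rightarrow> real"
    and n s :: nat
    and \<gamma> KF \<epsilon> \<delta> \<theta>\<^sub>1 \<theta>\<^sub>2 \<beta> \<alpha>max lam :: real
    and xstar x :: "real ^ 'p"
  assumes "F = average_fun n f"
    and "\<And>i. i \<in> {1..n} \<Longrightarrow> twice_differentiable (f i)"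
    and "\<And>i. i \<in> {1..n} \<Longrightarrow> 0 < K i"
    and "\<And>i z. i \<in> {1..n} \<Longrightarrow> 0 \<preceq>\<^sub>L hessian (f i) z \<and> hessian (f i) z \<preceq>\<^sub>L mat (K i)"
    and "0 < \<gamma>" and "\<gamma> \<le> KF"
    and "\<And>z. mat \<gamma> \<preceq>\<^sub>L hessian F z \<and> hessian F z \<preceq>\<^sub>L mat KF"
    and "is_arg_min F (\<lambda>_. True) xstar"
    and "0 < \<epsilon>" and "\<epsilon> < 1"
    and "0 < \<delta>" and "\<delta> < 1"
    and "0 \<le> \<theta>\<^sub>1"
    and "0 < \<theta>\<^sub>2" and "\<theta>\<^sub>2 < 1"
    and "0 < \<beta>" and "\<beta> < 1"
    and "1 \<le> \<alpha>max"
    and "0 < lam"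
    and "s \<in> {1..n}"
    and "real s \<ge> 2 * kappa n K \<gamma> 1 * ln (real CARD('p) / \<delta>) / \<epsilon>\<^sup>2"
  shows "measure_pmf.prob (sample_without_replacement n s)
     {S. \<forall>p \<alpha> y. ridge_newton_step n f lam \<theta>\<^sub>1 \<theta>\<^sub>2 \<beta> \<alpha>max S x p \<alpha> y \<longrightarrow>
        (\<theta>\<^sub>1 \<le> 1 / 2 * sqrt (((1 - \<epsilon>) * \<gamma> + lam) / (Khat n K s + lam)) \<longrightarrow>
           F y - F xstar \<le> (1 - \<alpha> * \<beta> * \<gamma> / (Khat n K s + lam)) * (F x - F xstar)) \<and>
        \<alpha> \<ge> min \<alpha>max (2 * (1 - \<theta>\<^sub>2) * (1 - \<beta>) * ((1 - \<epsilon>) * \<gamma> + lam) / KF)}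
     \<ge> 1 - \<delta>"
proof -
  note F = assms(1) and f = assms(2) and K = assms(3) and hess = assms(4)
  have s: "1 \<le> s" "s \<le> n"
    using assms(20) by auto
  define X where "X j = hessian (f j) x" for j
  \<comment> \<open>The largest \<open>K j\<close>, a common bound for the eigenvalues of all
    \<open>X j\<close>; this is how \<open>kappa n K \<gamma> 1\<close> enters the sample
    size.\<close>
  define L where "L = Khat n K 1"
  define m where "m = (1 - \<epsilon>) * \<gamma> + lam"
  define bad where "bad = {S. \<exists>v. v \<bullet> ((\<Sum>j\<in>S. X j) *v v) < real s * ((1 - \<epsilon>) * \<gamma>) * (v \<bullet> v)}"
  have F2: "twice_differentiable F"
    unfolding F using f by (rule average_fun_derivatives(1))
  have KL: "K j \<le> L" if "j \<in> {1..n}" for j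
    unfolding L_def using that by (rule le_Khat_1)
  have L: "0 < L"
    using KL[of 1] K[of 1] s by simp
  have m: "0 < m"
    using assms by (simp add: m_def add_nonneg_pos)
  have quadX: "0 \<le> v \<bullet> (X j *v v)" "v \<bullet> (X j *v v) \<le> L * (v \<bullet> v)" if j: "j \<in> {1..n}" for j v
  proof -
    show "0 \<le> v \<bullet> (X j *v v)"
      using loewner_le_quadratic_form[of 0 "X j" v] hess[OF j] by (simp add: X_def)
    have "v \<bullet> (X j *v v) \<le> K j * (v \<bullet> v)"
      using loewner_le_quadratic_form[of "X j" "mat (K j)" v] hess[OF j] by (simp add: X_def mat_vector_mult)
    also have "\<dots> \<le> L * (v \<bullet> v)"
      using KL[OF j] by (rule mult_right_mono) simp
    finally show "v \<bullet> (X j *v v) \<le> L * (v \<bullet> v)" .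
  qed
  have meanX: "real n * (\<gamma> * (v \<bullet> v)) \<le> (\<Sum>j = 1..n. v \<bullet> (X j *v v))" for v
  proof -
    have "\<gamma> * (v \<bullet> v) \<le> v \<bullet> (hessian F x *v v)"
      using loewner_le_quadratic_form[of "mat \<gamma>" "hessian F x" v] assms(7) by (simp add: mat_vector_mult)
    also have "hessian F x = (1 / real n) *\<^sub>R (\<Sum>j = 1..n. X j)"
      unfolding F X_def using f by (rule average_fun_derivatives(2))
    also have "v \<bullet> (\<dots> *v v) = (\<Sum>j = 1..n. v \<bullet> (X j *v v)) / real n"
      by (simp add: scaleR_matrix_vector_assoc[symmetric]
          matrix_vector_mult_sum inner_sum_right)
    finally show ?thesis
      using s by (simp add: field_simps)
  qed
  have "measure_pmf.prob (sample_without_replacement n s) bad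
      \<le> real CARD('p) * exp (- (\<epsilon>\<^sup>2 * real s * \<gamma> / (2 * L)))"
    unfolding bad_def
  proof (rule matrix_chernoff_without_replacement)
    show "transpose (X j) = X j" if "j \<in> {1..n}" for j
      using hess[OF that, of x] by (simp add: X_def loewner_le_def)
  qed (use s quadX meanX L assms in auto)
  also have "\<dots> \<le> real CARD('p) * exp (- ln (real CARD('p) / \<delta>))"
  proof -
    \<comment> \<open>The sample size makes the Chernoff exponent at least
      \<open>ln (real CARD('p) / \<delta>)\<close>, which cancels the dimension factor and leaves
      \<open>\<delta>\<close>.\<close>
    have "2 * (L / \<gamma>) * ln (real CARD('p) / \<delta>) / \<epsilon>\<^sup>2 \<le> real s"
      using assms(21) by (simp add: kappa_def L_def)
    then have "ln (real CARD('p) / \<delta>) \<le> \<epsilon>\<^sup>2 * real s * \<gamma> / (2 * L)"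
      using L \<open>0 < \<gamma>\<close> \<open>0 < \<epsilon>\<close> by (simp add: field_simps)
    then show ?thesis
      by simp
  qed
  also have "\<dots> = \<delta>"
    using \<open>0 < \<delta>\<close> by (simp add: exp_minus)
  finally have bad: "measure_pmf.prob (sample_without_replacement n s) bad \<le> \<delta>" .
  \<comment> \<open>From here the argument is deterministic: outside \<open>bad\<close>, the
    regularized Hessian has all eigenvalues between \<open>m\<close> and
    \<open>Khat n K s + lam\<close>.\<close>
  have good: "\<forall>p \<alpha> y. ridge_newton_step n f lam \<theta>\<^sub>1 \<theta>\<^sub>2 \<beta> \<alpha>max S x p \<alpha> y \<longrightarrow>
        (\<theta>\<^sub>1 \<le> 1 / 2 * sqrt (((1 - \<epsilon>) * \<gamma> + lam) / (Khat n K s + lam)) \<longrightarrow>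
           F y - F xstar \<le> (1 - \<alpha> * \<beta> * \<gamma> / (Khat n K s + lam)) * (F x - F xstar)) \<and>
        \<alpha> \<ge> min \<alpha>max (2 * (1 - \<theta>\<^sub>2) * (1 - \<beta>) * ((1 - \<epsilon>) * \<gamma> + lam) / KF)"
    if S: "S \<subseteq> {1..n}" "card S = s" and "S \<notin> bad" for S
  proof (intro allI impI)
    fix p \<alpha> y
    let ?H = "ridge_hessian f lam S x" and ?M = "Khat n K s + lam"
    assume "ridge_newton_step n f lam \<theta>\<^sub>1 \<theta>\<^sub>2 \<beta> \<alpha>max S x p \<alpha> y"
    then have p: "inexact_direction ?H (gradient F x) \<theta>\<^sub>1 \<theta>\<^sub>2 p"
      and ls: "line_search_step F \<beta> \<alpha>max x p \<alpha>" and y: "y = x + \<alpha> *\<^sub>R p"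
      by (simp_all add: ridge_newton_step_def F)
    have "0 < s"
      using s by simp
    have H: "transpose ?H = ?H"
      using S \<open>0 < s\<close> hess by (rule ridge_hessian_bounds(1))
    have quadH: "v \<bullet> (?H *v v) = (v \<bullet> ((\<Sum>j\<in>S. X j) *v v)) / real s + lam * (v \<bullet> v)" for v
      unfolding X_def using S \<open>0 < s\<close> hess by (rule ridge_hessian_bounds(2))
    have HM: "v \<bullet> (?H *v v) \<le> ?M * (v \<bullet> v)" for v
      using S \<open>0 < s\<close> hess by (rule ridge_hessian_bounds(3))
    have mH: "m * (v \<bullet> v) \<le> v \<bullet> (?H *v v)" for v
    proof -
      have "real s * ((1 - \<epsilon>) * \<gamma>) * (v \<bullet> v) \<le> v \<bullet> ((\<Sum>j\<in>S. X j) *v v)"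
        using \<open>S \<notin> bad\<close> by (auto simp: bad_def not_less)
      then show ?thesis
        unfolding quadH using \<open>0 < s\<close> by (simp add: m_def field_simps)
    qed
    have "m \<le> ?M"
      using mH[of "axis undefined 1"] HM[of "axis undefined 1"] by (simp add: inner_axis_axis)
    then have M: "0 < ?M"
      using m by simp
    have "F y - F xstar \<le> (1 - \<alpha> * \<beta> * \<gamma> / ?M) * (F x - F xstar)" if "\<theta>\<^sub>1 \<le> 1 / 2 * sqrt (m / ?M)"
      unfolding y
    proof (rule line_search_contraction[OF F2 \<open>0 < \<gamma>\<close> _ ls])
      show "p \<bullet> gradient F x \<le> - (gradient F x \<bullet> gradient F x) / (2 * ?M)"
        using H m mH HM p assms(13) that by (rule inexact_direction_descent)
    qed (use assms M in auto)
    moreover have "min \<alpha>max (2 * (1 - \<theta>\<^sub>2) * (1 - \<beta>) * m / KF) \<le> \<alpha>"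
      by (rule line_search_step_size[OF F2 _ _ mH _ p ls]) (use assms m in auto)
    ultimately show "(\<theta>\<^sub>1 \<le> 1 / 2 * sqrt (((1 - \<epsilon>) * \<gamma> + lam) / ?M) \<longrightarrow>
           F y - F xstar \<le> (1 - \<alpha> * \<beta> * \<gamma> / ?M) * (F x - F xstar)) \<and>
        \<alpha> \<ge> min \<alpha>max (2 * (1 - \<theta>\<^sub>2) * (1 - \<beta>) * ((1 - \<epsilon>) * \<gamma> + lam) / KF)"
      by (simp add: m_def)
  qed
  have "{S. S \<subseteq> {1..n} \<and> card S = s} \<noteq> {}"
    using s obtain_subset_with_card_n[of s "{1..n}"] by auto
  then have support: "set_pmf (sample_without_replacement n s) = {S. S \<subseteq> {1..n} \<and> card S = s}"
    unfolding sample_without_replacement_def by (rule set_pmf_of_set) simp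
  have "1 - \<delta> \<le> measure_pmf.prob (sample_without_replacement n s) (- bad)"
    using bad measure_pmf.prob_compl[of bad "sample_without_replacement n s"] by (simp add: Compl_eq_Diff_UNIV)
  also have "\<dots> \<le> measure_pmf.prob (sample_without_replacement n s)
     {S. \<forall>p \<alpha> y. ridge_newton_step n f lam \<theta>\<^sub>1 \<theta>\<^sub>2 \<beta> \<alpha>max S x p \<alpha> y \<longrightarrow>
        (\<theta>\<^sub>1 \<le> 1 / 2 * sqrt (((1 - \<epsilon>) * \<gamma> + lam) / (Khat n K s + lam)) \<longrightarrow>
           F y - F xstar \<le> (1 - \<alpha> * \<beta> * \<gamma> / (Khat n K s + lam)) * (F x - F xstar)) \<and>
        \<alpha> \<ge> min \<alpha>max (2 * (1 - \<theta>\<^sub>2) * (1 - \<beta>) * ((1 - \<epsilon>) * \<gamma> + lam) / KF)}"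
  \<comment> \<open>The complement of \<open>bad\<close> also contains sets that are not samples, to
    which \<open>good\<close> does not apply, so the inclusion is shown only on the support.\<close>
  proof (rule measure_pmf.finite_measure_mono_AE)
    show "AE S in measure_pmf (sample_without_replacement n s). S \<in> - bad \<longrightarrow>
      S \<in> {S. \<forall>p \<alpha> y. ridge_newton_step n f lam \<theta>\<^sub>1 \<theta>\<^sub>2 \<beta> \<alpha>max S x p \<alpha> y \<longrightarrow>
        (\<theta>\<^sub>1 \<le> 1 / 2 * sqrt (((1 - \<epsilon>) * \<gamma> + lam) / (Khat n K s + lam)) \<longrightarrow>
           F y - F xstar \<le> (1 - \<alpha> * \<beta> * \<gamma> / (Khat n K s + lam)) * (F x - F xstar)) \<and>
        \<alpha> \<ge> min \<alpha>max (2 * (1 - \<theta>\<^sub>2) * (1 - \<beta>) * ((1 - \<epsilon>) * \<gamma> + lam) / KF)}"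
      unfolding AE_measure_pmf_iff support using good by blast
  qed simp
  finally show ?thesis .
qed

end
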